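(* Let $I$ be a small category and let $(\mathbf{s},\mu,\lambda)$ be a simplicial descent structure on $(\mathcal{D},\mathrm{E})$. Then the triple $(\mathbf{s}_{I\mathcal{D}},\mu_{I\mathcal{D}},\lambda_{I\mathcal{D}})$ defined objectwise is a simplicial descent structure on $(I\mathcal{D},I\mathrm{E})$, where $I\mathcal{D}$ is the category of functors from $I$ to $\mathcal{D}$ and $I\mathrm{E}$ is the class of natural transformations $\alpha$ with $\alpha_i\in\mathrm{E}$ for all $i\in I$. Here, for $X:\Delta^{op}\to I\mathcal{D}$, $(\mathbf{s}_{I\mathcal{D}}(X))(i)=\mathbf{s}(n\mapsto X_n(i))$, and $\mu_{I\mathcal{D}}$, $\lambda_{I\mathcal{D}}$ are defined analogously.
   Context: **Simplicial descent structures.** $\Delta$ is the category of ordered sets $[n]=\{0,\dots,n\}$ and order preserving maps. $\Delta^{op}\mathcal{D}$ is the category of simplicial objects in $\mathcal{D}$; $c(A)$ is the constant simplicial object on $A$; $\mathrm{D}(Z)_n=Z_{n,n}$ is the diagonal of a bisimplicial object. If $\mathcal D$ has finite coproducts and $K$ is a simplicial finite set, $(X\boxtimes K)_n=\coprod_{K_n}X_n$; the map $d^0:[0]\to[1]$ induces $d_0^X:X\to X\boxtimes\Delta[1]$, and we write $A$ for $c(A)$. A class $\mathrm{E}$ of morphisms of $\mathcal{D}$ is saturated if it consists of exactly the morphisms that become invertible in $\mathcal{D}[\mathrm{E}^{-1}]$. A relative category $(\mathcal{D},\mathrm{E})$ is a category with a saturated class of morphisms (weak equivalences); it is closed by finite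 coproducts if $\mathcal{D}$ has an initial object and finite coproducts, and $f\sqcup g\in\mathrm{E}$ whenever $f,g\in\mathrm{E}$. A zigzag of natural weak equivalences $F\dashrightarrow G$ is a finite chain of natural transformations, in either direction, connecting $F$ to $G$, each objectwise in $\mathrm{E}$; $Fun(\mathcal{C},\mathcal{D})[\mathrm{E}^{-1}]$ is the localization at the objectwise weak equivalences. A simplicial descent structure on a relative category $(\mathcal{D},\mathrm{E})$ closed by finite coproducts is a triple $(\mathbf{s},\mu,\lambda)$ with: (S1) $\mathbf{s}:\Delta^{op}\mathcal{D}\to\mathcal{D}$ is a functor (the simple functor) such that $\mathbf{s}(X)\sqcup\mathbf{s}(Y)\to\mathbf{s}(X\sqcup Y)$ is in $\mathrm{E}$ for all $X,Y$. (S2) $\mu:\mathbf{s}\circ\mathrm{D}\dashrightarrow\mathbf{s}\circ\mathbf{s}$ is a zigzag of natural weak equivalences, where $\mathbf{s}\mathbf{s}(Z)=\mathbf{s}(n\mapsto\mathbf{s}(m\mapsto Z_{n,m}))$. (S3) $\lambda:\mathbf{s}\circ c\dashrightarrow 1_{\mathcal{D}}$ is a zigzag of natural weak equivalences compatible with $\mu$: with $(X\times\Delta)_{n,m}=X_n$, $(\Delta\times X)_{n,m}=X_m$, the composites $\mathbf{s}(X)\xrightarrow{\mu_{\Delta\times X}}\mathbf{s}c\mathbf{s}(X)\xrightarrow{\lambda_{\mathbf{s}(X)}}\mathbf{s}(X)$ and $\mathbf{s}(X)\xrightarrow{\mu_{X\times\Delta}}\mathbf{s}(n\mapsto\mathbf{s}c(X_n))\xrightarrow{\mathbf{s}(\lambda_X)}\mathbf{s}(X)$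 are the identity in $Fun(\Delta^{op}\mathcal{D},\mathcal{D})[\mathrm{E}^{-1}]$. (S4) If $f:X\to Y$ in $\Delta^{op}\mathcal{D}$ has $f_n\in\mathrm{E}$ for all $n$, then $\mathbf{s}(f)\in\mathrm{E}$. (S5) $\mathbf{s}(d_0^A:A\to A\boxtimes\Delta[1])\in\mathrm{E}$ for each object $A$ of $\mathcal{D}$. *)

theory Defs
  imports "HOL-Library.FuncSet"
begin

section \<open>Categories, functors, natural transformations\<close>

record ('o, 'm) cat =
  obj :: "'o set"
  arr :: "'m set"
  src :: "'m \<Rightarrow> 'o"
  tgt :: "'m \<Rightarrow> 'o"
  ident :: "'o \<Rightarrow> 'm"
  cmp :: "'m \<Rightarrow> 'm \<Rightarrow> 'm" (infixr "\<cdot>\<index>" 70)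

definition hom :: "('o, 'm) cat \<Rightarrow> 'o \<Rightarrow> 'o \<Rightarrow> 'm set" where
  "hom C A B = {f \<in> arr C. src C f = A \<and> tgt C f = B}"

locale category =
  fixes C :: "('o, 'm) cat" (structure)
  assumes src_obj: "f \<in> arr C \<Longrightarrow> src C f \<in> obj C"
    and tgt_obj: "f \<in> arr C \<Longrightarrow> tgt C f \<in> obj C"
    and ident_hom: "A \<in> obj C \<Longrightarrow> ident C A \<in> hom C A A"
    and cmp_hom: "f \<in> hom C A B \<Longrightarrow> g \<in> hom C B B' \<Longrightarrow> g \<cdot> f \<in> hom C A B'"
    and cmp_ident_left: "f \<in> hom C A B \<Longrightarrow> ident C B \<cdot> f = f"
    and cmp_ident_right: "f \<in> hom C A B \<Longrightarrow> f \<cdot> ident C A = f"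
    and cmp_assoc: "f \<in> hom C A B \<Longrightarrow> g \<in> hom C B B' \<Longrightarrow> h \<in> hom C B' B'' \<Longrightarrow>
      (h \<cdot> g) \<cdot> f = h \<cdot> (g \<cdot> f)"

definition is_iso :: "('o, 'm) cat \<Rightarrow> 'm \<Rightarrow> bool" where
  "is_iso C f \<longleftrightarrow> f \<in> arr C \<and> (\<exists>g \<in> hom C (tgt C f) (src C f).
     g \<cdot>\<^bsub>C\<^esub> f = ident C (src C f) \<and> f \<cdot>\<^bsub>C\<^esub> g = ident C (tgt C f))"

definition op_cat :: "('o, 'm) cat \<Rightarrow> ('o, 'm) cat" where
  "op_cat C = \<lparr>obj = obj C, arr = arr C, src = tgt C, tgt = src C, ident = ident C,
     cmp = (\<lambda>g f. f \<cdot>\<^bsub>C\<^esub> g)\<rparr>"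

record ('o, 'm, 'p, 'n) func =
  omap :: "'o \<Rightarrow> 'p"
  amap :: "'m \<Rightarrow> 'n"

text \<open>Functors and natural transformations are extensional (undefined outside the carriers of
  their domain category), so that equality of the HOL objects is the mathematical equality.\<close>

definition is_functor :: "('o, 'm) cat \<Rightarrow> ('p, 'n) cat \<Rightarrow> ('o, 'm, 'p, 'n) func \<Rightarrow> bool" where
  "is_functor A B F \<longleftrightarrow>
     omap F \<in> obj A \<rightarrow>\<^sub>E obj B \<and> amap F \<in> arr A \<rightarrow>\<^sub>E arr B \<and>
     (\<forall>f \<in> arr A. amap F f \<in> hom B (omap F (src A f)) (omap F (tgt A f))) \<and>
     (\<forall>a \<in> obj A. amap F (ident A a) = ident B (omap F a)) \<and>
     (\<forall>f \<in> arr A. \<forall>g \<in> arr A. tgt A f = src A g \<longrightarrow>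
        amap F (g \<cdot>\<^bsub>A\<^esub> f) = amap F g \<cdot>\<^bsub>B\<^esub> amap F f)"

record ('o, 'm, 'p, 'n) nt =
  nsrc :: "('o, 'm, 'p, 'n) func"
  ntgt :: "('o, 'm, 'p, 'n) func"
  component :: "'o \<Rightarrow> 'n"

definition is_nt :: "('o, 'm) cat \<Rightarrow> ('p, 'n) cat \<Rightarrow> ('o, 'm, 'p, 'n) nt \<Rightarrow> bool" where
  "is_nt A B t \<longleftrightarrow>
     is_functor A B (nsrc t) \<and> is_functor A B (ntgt t) \<and> component t \<in> extensional (obj A) \<and>
     (\<forall>a \<in> obj A. component t a \<in> hom B (omap (nsrc t) a) (omap (ntgt t) a)) \<and>
     (\<forall>f \<in> arr A. component t (tgt A f) \<cdot>\<^bsub>B\<^esub> amap (nsrc t) f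
        = amap (ntgt t) f \<cdot>\<^bsub>B\<^esub> component t (src A f))"

definition fun_cat :: "('o, 'm) cat \<Rightarrow> ('p, 'n) cat \<Rightarrow>
    (('o, 'm, 'p, 'n) func, ('o, 'm, 'p, 'n) nt) cat" where
  "fun_cat A B = \<lparr>obj = {F. is_functor A B F}, arr = {t. is_nt A B t}, src = nsrc, tgt = ntgt,
     ident = (\<lambda>F. \<lparr>nsrc = F, ntgt = F, component = (\<lambda>a \<in> obj A. ident B (omap F a))\<rparr>),
     cmp = (\<lambda>t u. \<lparr>nsrc = nsrc u, ntgt = ntgt t,
                    component = (\<lambda>a \<in> obj A. component t a \<cdot>\<^bsub>B\<^esub> component u a)\<rparr>)\<rparr>"

text \<open>The argument \<open>A\<close> below is always the domain category of the functor or
  transformation being constructed; it is only needed to make the result extensional.\<close>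

definition id_functor :: "('o, 'm) cat \<Rightarrow> ('o, 'm, 'o, 'm) func" where
  "id_functor A = \<lparr>omap = (\<lambda>a \<in> obj A. a), amap = (\<lambda>f \<in> arr A. f)\<rparr>"

definition functor_comp :: "('o, 'm) cat \<Rightarrow> ('p, 'n, 'q, 'r) func \<Rightarrow> ('o, 'm, 'p, 'n) func \<Rightarrow>
    ('o, 'm, 'q, 'r) func" where
  "functor_comp A G F = \<lparr>omap = compose (obj A) (omap G) (omap F),
                  amap = compose (arr A) (amap G) (amap F)\<rparr>"

text \<open>The whiskerings \<open>t H\<close> (components \<open>t (H a)\<close>) and \<open>K t\<close> (components \<open>K (t a)\<close>).\<close>

definition whisker_right :: "('o, 'm) cat \<Rightarrow> ('p, 'n, 'q, 'r) nt \<Rightarrow> ('o, 'm, 'p, 'n) func \<Rightarrow>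
    ('o, 'm, 'q, 'r) nt" where
  "whisker_right A t H = \<lparr>nsrc = functor_comp A (nsrc t) H, ntgt = functor_comp A (ntgt t) H,
     component = (\<lambda>a \<in> obj A. component t (omap H a))\<rparr>"

definition whisker_left :: "('o, 'm) cat \<Rightarrow> ('p, 'n, 'q, 'r) func \<Rightarrow> ('o, 'm, 'p, 'n) nt \<Rightarrow>
    ('o, 'm, 'q, 'r) nt" where
  "whisker_left A K t = \<lparr>nsrc = functor_comp A K (nsrc t), ntgt = functor_comp A K (ntgt t),
     component = (\<lambda>a \<in> obj A. amap K (component t a))\<rparr>"

text \<open>For \<open>F : B \<rightarrow> B'\<close>, the functor \<open>Fun(A,B) \<rightarrow> Fun(A,B')\<close> of postcomposition with \<open>F\<close>, and its
  action on a natural transformation \<open>t : F \<rightarrow> G\<close>.\<close>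

definition post :: "('o, 'm) cat \<Rightarrow> ('p, 'n) cat \<Rightarrow> ('p, 'n, 'q, 'r) func \<Rightarrow>
    (('o, 'm, 'p, 'n) func, ('o, 'm, 'p, 'n) nt, ('o, 'm, 'q, 'r) func, ('o, 'm, 'q, 'r) nt) func"
  where
  "post A B F = \<lparr>omap = (\<lambda>X \<in> obj (fun_cat A B). functor_comp A F X),
                 amap = (\<lambda>t \<in> arr (fun_cat A B). whisker_left A F t)\<rparr>"

definition post_nt :: "('o, 'm) cat \<Rightarrow> ('p, 'n) cat \<Rightarrow> ('p, 'n, 'q, 'r) nt \<Rightarrow>
    (('o, 'm, 'p, 'n) func, ('o, 'm, 'p, 'n) nt, ('o, 'm, 'q, 'r) func, ('o, 'm, 'q, 'r) nt) nt"
  where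
  "post_nt A B t = \<lparr>nsrc = post A B (nsrc t), ntgt = post A B (ntgt t),
     component = (\<lambda>X \<in> obj (fun_cat A B). whisker_right A t X)\<rparr>"

text \<open>The functor \<open>B \<rightarrow> Fun(A,B)\<close> sending an object to the corresponding constant functor.\<close>

definition const_ob :: "('o, 'm) cat \<Rightarrow> ('p, 'n) cat \<Rightarrow> 'p \<Rightarrow> ('o, 'm, 'p, 'n) func" where
  "const_ob A B b = \<lparr>omap = (\<lambda>a \<in> obj A. b), amap = (\<lambda>f \<in> arr A. ident B b)\<rparr>"

definition const_functor :: "('o, 'm) cat \<Rightarrow> ('p, 'n) cat \<Rightarrow>
    ('p, 'n, ('o, 'm, 'p, 'n) func, ('o, 'm, 'p, 'n) nt) func" where
  "const_functor A B = \<lparr>omap = (\<lambda>b \<in> obj B. const_ob A B b),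
     amap = (\<lambda>g \<in> arr B. \<lparr>nsrc = const_ob A B (src B g), ntgt = const_ob A B (tgt B g),
                           component = (\<lambda>a \<in> obj A. g)\<rparr>)\<rparr>"

text \<open>For \<open>X : A \<rightarrow> Fun(B,C)\<close> and an object \<open>b\<close> of \<open>B\<close>, \<open>slice A X b : A \<rightarrow> C\<close> is \<open>a \<mapsto> X(a)(b)\<close>;
  \<open>swap A B C : Fun(A, Fun(B,C)) \<rightarrow> Fun(B, Fun(A,C))\<close> exchanges the two variables.\<close>

definition slice :: "('a, 'a1) cat \<Rightarrow>
    ('a, 'a1, ('b, 'b1, 'c, 'c1) func, ('b, 'b1, 'c, 'c1) nt) func \<Rightarrow> 'b \<Rightarrow> ('a, 'a1, 'c, 'c1) func"
  where
  "slice A X b = \<lparr>omap = (\<lambda>a \<in> obj A. omap (omap X a) b),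
                  amap = (\<lambda>f \<in> arr A. component (amap X f) b)\<rparr>"

definition swap_ob :: "('a, 'a1) cat \<Rightarrow> ('b, 'b1) cat \<Rightarrow>
    ('a, 'a1, ('b, 'b1, 'c, 'c1) func, ('b, 'b1, 'c, 'c1) nt) func \<Rightarrow>
    ('b, 'b1, ('a, 'a1, 'c, 'c1) func, ('a, 'a1, 'c, 'c1) nt) func" where
  "swap_ob A B X = \<lparr>omap = (\<lambda>b \<in> obj B. slice A X b),
     amap = (\<lambda>g \<in> arr B. \<lparr>nsrc = slice A X (src B g), ntgt = slice A X (tgt B g),
                           component = (\<lambda>a \<in> obj A. amap (omap X a) g)\<rparr>)\<rparr>"

definition swap :: "('a, 'a1) cat \<Rightarrow> ('b, 'b1) cat \<Rightarrow> ('c, 'c1) cat \<Rightarrow>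
    (('a, 'a1, ('b, 'b1, 'c, 'c1) func, ('b, 'b1, 'c, 'c1) nt) func,
     ('a, 'a1, ('b, 'b1, 'c, 'c1) func, ('b, 'b1, 'c, 'c1) nt) nt,
     ('b, 'b1, ('a, 'a1, 'c, 'c1) func, ('a, 'a1, 'c, 'c1) nt) func,
     ('b, 'b1, ('a, 'a1, 'c, 'c1) func, ('a, 'a1, 'c, 'c1) nt) nt) func" where
  "swap A B C = \<lparr>omap = (\<lambda>X \<in> obj (fun_cat A (fun_cat B C)). swap_ob A B X),
     amap = (\<lambda>t \<in> arr (fun_cat A (fun_cat B C)).
       \<lparr>nsrc = swap_ob A B (nsrc t), ntgt = swap_ob A B (ntgt t),
        component = (\<lambda>b \<in> obj B. \<lparr>nsrc = slice A (nsrc t) b, ntgt = slice A (ntgt t) b,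
                              component = (\<lambda>a \<in> obj A. component (component t a) b)\<rparr>)\<rparr>)\<rparr>"


section \<open>Coproducts\<close>

definition is_coproduct :: "('o, 'm) cat \<Rightarrow> 'j set \<Rightarrow> ('j \<Rightarrow> 'o) \<Rightarrow> 'o \<Rightarrow> ('j \<Rightarrow> 'm) \<Rightarrow> bool" where
  "is_coproduct C J X P \<iota> \<longleftrightarrow>
     P \<in> obj C \<and> (\<forall>j \<in> J. X j \<in> obj C \<and> \<iota> j \<in> hom C (X j) P) \<and>
     (\<forall>Y \<in> obj C. \<forall>f. (\<forall>j \<in> J. f j \<in> hom C (X j) Y) \<longrightarrow>
        (\<exists>!h. h \<in> hom C P Y \<and> (\<forall>j \<in> J. h \<cdot>\<^bsub>C\<^esub> \<iota> j = f j)))"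

definition is_bin_coproduct :: "('o, 'm) cat \<Rightarrow> 'o \<Rightarrow> 'o \<Rightarrow> 'o \<Rightarrow> 'm \<Rightarrow> 'm \<Rightarrow> bool" where
  "is_bin_coproduct C A B P i j \<longleftrightarrow>
     is_coproduct C UNIV (case_bool A B) P (case_bool i j)"

text \<open>The case of the empty index set gives the initial object.\<close>

definition has_finite_coproducts :: "('o, 'm) cat \<Rightarrow> bool" where
  "has_finite_coproducts C \<longleftrightarrow>
     (\<forall>J :: nat set. finite J \<longrightarrow> (\<forall>X \<in> J \<rightarrow> obj C. \<exists>P \<iota>. is_coproduct C J X P \<iota>))"


section \<open>Zigzags, localization and saturation\<close>

text \<open>A zigzag from \<open>A\<close> to \<open>B\<close> is a list of arrows read from left to right starting at \<open>A\<close>: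
  \<open>Fwd f\<close> traverses \<open>f\<close> forwards, \<open>Bwd w\<close> traverses \<open>w \<in> W\<close> backwards.\<close>

datatype (step_arrs: 'm) step = Fwd 'm | Bwd 'm

fun zigzag :: "('o, 'm) cat \<Rightarrow> 'm set \<Rightarrow> 'o \<Rightarrow> 'm step list \<Rightarrow> 'o \<Rightarrow> bool" where
  "zigzag C W A [] B \<longleftrightarrow> A = B \<and> A \<in> obj C"
| "zigzag C W A (Fwd f # p) B \<longleftrightarrow> f \<in> arr C \<and> src C f = A \<and> zigzag C W (tgt C f) p B"
| "zigzag C W A (Bwd w # p) B \<longleftrightarrow> w \<in> arr C \<inter> W \<and> tgt C w = A \<and> zigzag C W (src C w) p B"

definition we_zigzag :: "('o, 'm) cat \<Rightarrow> 'm set \<Rightarrow> 'o \<Rightarrow> 'm step list \<Rightarrow> 'o \<Rightarrow> bool" where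
  "we_zigzag C W A p B \<longleftrightarrow> zigzag C W A p B \<and> (\<forall>x \<in> set p. step_arrs x \<subseteq> W)"

text \<open>\<open>loc_eq C W A B\<close> is the congruence on zigzags from \<open>A\<close> to \<open>B\<close> whose classes are the morphisms
  \<open>A \<rightarrow> B\<close> of the Gabriel-Zisman localization \<open>C[W\<^sup>-\<^sup>1]\<close>.\<close>

inductive loc_eq :: "('o, 'm) cat \<Rightarrow> 'm set \<Rightarrow> 'o \<Rightarrow> 'o \<Rightarrow> 'm step list \<Rightarrow> 'm step list \<Rightarrow> bool"
  for C W where
  refl: "zigzag C W A p B \<Longrightarrow> loc_eq C W A B p p"
| sym: "loc_eq C W A B p q \<Longrightarrow> loc_eq C W A B q p"
| trans: "loc_eq C W A B p q \<Longrightarrow> loc_eq C W A B q r \<Longrightarrow> loc_eq C W A B p r"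
| append: "loc_eq C W A B p p' \<Longrightarrow> loc_eq C W B B' q q' \<Longrightarrow> loc_eq C W A B' (p @ q) (p' @ q')"
| ident: "A \<in> obj C \<Longrightarrow> loc_eq C W A A [Fwd (ident C A)] []"
| cmp: "f \<in> hom C A B \<Longrightarrow> g \<in> hom C B B' \<Longrightarrow> loc_eq C W A B' [Fwd f, Fwd g] [Fwd (g \<cdot>\<^bsub>C\<^esub> f)]"
| inv_right: "w \<in> hom C A B \<Longrightarrow> w \<in> W \<Longrightarrow> loc_eq C W A A [Fwd w, Bwd w] []"
| inv_left: "w \<in> hom C A B \<Longrightarrow> w \<in> W \<Longrightarrow> loc_eq C W B B [Bwd w, Fwd w] []"

definition loc_arr :: "('o, 'm) cat \<Rightarrow> 'm set \<Rightarrow> 'o \<Rightarrow> 'm step list \<Rightarrow> 'o \<Rightarrow>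
    'o \<times> 'o \<times> 'm step list set" where
  "loc_arr C W A p B = (A, B, {q. loc_eq C W A B p q})"

definition localization :: "('o, 'm) cat \<Rightarrow> 'm set \<Rightarrow> ('o, 'o \<times> 'o \<times> 'm step list set) cat" where
  "localization C W = \<lparr>obj = obj C,
     arr = {loc_arr C W A p B | A p B. zigzag C W A p B},
     src = (\<lambda>(A, B, P). A), tgt = (\<lambda>(A, B, P). B),
     ident = (\<lambda>A. loc_arr C W A [] A),
     cmp = (\<lambda>(B, B', Q) (A, _, P). (A, B', {r. \<exists>p \<in> P. \<exists>q \<in> Q. loc_eq C W A B' (p @ q) r}))\<rparr>"

definition saturated :: "('o, 'm) cat \<Rightarrow> 'm set \<Rightarrow> bool" where
  "saturated C W \<longleftrightarrow>
     W = {f \<in> arr C. is_iso (localization C W) (loc_arr C W (src C f) [Fwd f] (tgt C f))}"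

locale relative_category = category D for D :: "('o, 'm) cat" (structure) +
  fixes E :: "'m set"
  assumes saturated: "saturated D E"

locale relative_category_fin_coprod = relative_category +
  assumes finite_coproducts: "has_finite_coproducts D"
    and coprod_weq: "f \<in> E \<Longrightarrow> g \<in> E \<Longrightarrow>
      is_bin_coproduct D (src D f) (src D g) P i j \<Longrightarrow>
      is_bin_coproduct D (tgt D f) (tgt D g) Q k l \<Longrightarrow>
      h \<in> hom D P Q \<Longrightarrow> h \<cdot> i = k \<cdot> f \<Longrightarrow> h \<cdot> j = l \<cdot> g \<Longrightarrow> h \<in> E"

definition objectwise :: "('o, 'm) cat \<Rightarrow> ('p, 'n) cat \<Rightarrow> 'n set \<Rightarrow> ('o, 'm, 'p, 'n) nt set" where
  "objectwise A B E = {t \<in> arr (fun_cat A B). \<forall>a \<in> obj A. component t a \<in> E}"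


section \<open>Simplicial objects\<close>

text \<open>The ordered set \<open>[n]\<close> is encoded by \<open>n\<close>, its elements being \<open>{..n}\<close>.\<close>

record smap =
  dsrc :: nat
  dtgt :: nat
  dfun :: "nat \<Rightarrow> nat"

definition Delta :: "(nat, smap) cat" where
  "Delta = \<lparr>obj = UNIV,
     arr = {f. dfun f \<in> {..dsrc f} \<rightarrow>\<^sub>E {..dtgt f} \<and> mono_on {..dsrc f} (dfun f)},
     src = dsrc, tgt = dtgt,
     ident = (\<lambda>n. \<lparr>dsrc = n, dtgt = n, dfun = (\<lambda>x \<in> {..n}. x)\<rparr>),
     cmp = (\<lambda>g f. \<lparr>dsrc = dsrc f, dtgt = dtgt g, dfun = compose {..dsrc f} (dfun g) (dfun f)\<rparr>)\<rparr>"

abbreviation Dop :: "(nat, smap) cat" where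
  "Dop \<equiv> op_cat Delta"

type_synonym ('o, 'm) sobj = "(nat, smap, 'o, 'm) func"
type_synonym ('o, 'm) sarr = "(nat, smap, 'o, 'm) nt"
type_synonym ('o, 'm) bisobj = "(('o, 'm) sobj, ('o, 'm) sarr) sobj"
type_synonym ('o, 'm) bisarr = "(('o, 'm) sobj, ('o, 'm) sarr) sarr"

abbreviation scat :: "('o, 'm) cat \<Rightarrow> (('o, 'm) sobj, ('o, 'm) sarr) cat" where
  "scat D \<equiv> fun_cat Dop D"

text \<open>A bisimplicial object \<open>Z\<close> is a simplicial object in \<open>scat D\<close>, with \<open>Z\<^sub>n\<^sub>,\<^sub>m = (Z\<^sub>n)\<^sub>m\<close>.\<close>

definition diag_ob :: "('o, 'm) cat \<Rightarrow> ('o, 'm) bisobj \<Rightarrow> ('o, 'm) sobj" where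
  "diag_ob D Z = \<lparr>omap = (\<lambda>n \<in> obj Dop. omap (omap Z n) n),
     amap = (\<lambda>\<theta> \<in> arr Dop.
       amap (omap Z (tgt Dop \<theta>)) \<theta> \<cdot>\<^bsub>D\<^esub> component (amap Z \<theta>) (src Dop \<theta>))\<rparr>"

definition diag :: "('o, 'm) cat \<Rightarrow>
    (('o, 'm) bisobj, ('o, 'm) bisarr, ('o, 'm) sobj, ('o, 'm) sarr) func" where
  "diag D = \<lparr>omap = (\<lambda>Z \<in> obj (scat (scat D)). diag_ob D Z),
     amap = (\<lambda>t \<in> arr (scat (scat D)). \<lparr>nsrc = diag_ob D (nsrc t), ntgt = diag_ob D (ntgt t),
       component = (\<lambda>n \<in> obj Dop. component (component t n) n)\<rparr>)\<rparr>"

text \<open>\<open>simple_simple D s\<close> is \<open>Z \<mapsto> s(n \<mapsto> s(m \<mapsto> Z\<^sub>n\<^sub>,\<^sub>m))\<close>.\<close>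

definition simple_simple :: "('o, 'm) cat \<Rightarrow> (('o, 'm) sobj, ('o, 'm) sarr, 'o, 'm) func \<Rightarrow>
    (('o, 'm) bisobj, ('o, 'm) bisarr, 'o, 'm) func" where
  "simple_simple D s = functor_comp (scat (scat D)) s (post Dop (scat D) s)"

record 'k sset =
  simplices :: "nat \<Rightarrow> 'k set"
  act :: "smap \<Rightarrow> 'k \<Rightarrow> 'k"

definition std_simplex :: "nat \<Rightarrow> smap sset" where
  "std_simplex p = \<lparr>simplices = (\<lambda>n. hom Delta n p), act = (\<lambda>\<theta> k. k \<cdot>\<^bsub>Delta\<^esub> \<theta>)\<rparr>"

text \<open>\<open>is_tensor D X K T \<iota>\<close>: the simplicial object \<open>T\<close> is \<open>X \<boxtimes> K\<close>, where \<open>\<iota> n k\<close> is the inclusion of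
  the summand of \<open>T\<^sub>n\<close>, a coproduct of copies of \<open>X\<^sub>n\<close>, with index \<open>k\<close>.\<close>

definition is_tensor :: "('o, 'm) cat \<Rightarrow> ('o, 'm) sobj \<Rightarrow> 'k sset \<Rightarrow> ('o, 'm) sobj \<Rightarrow>
    (nat \<Rightarrow> 'k \<Rightarrow> 'm) \<Rightarrow> bool" where
  "is_tensor D X K T \<iota> \<longleftrightarrow> T \<in> obj (scat D) \<and>
     (\<forall>n. is_coproduct D (simplices K n) (\<lambda>_. omap X n) (omap T n) (\<iota> n)) \<and>
     (\<forall>\<theta> \<in> arr Delta. \<forall>k \<in> simplices K (dtgt \<theta>).
        amap T \<theta> \<cdot>\<^bsub>D\<^esub> \<iota> (dtgt \<theta>) k = \<iota> (dsrc \<theta>) (act K \<theta> k) \<cdot>\<^bsub>D\<^esub> amap X \<theta>)"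

text \<open>The coface \<open>d\<^sup>0 : [0] \<rightarrow> [1]\<close> omits \<open>0\<close>. It induces \<open>X = X \<boxtimes> \<Delta>[0] \<rightarrow> X \<boxtimes> \<Delta>[1]\<close>, which in degree \<open>n\<close>
  is the inclusion of the summand indexed by \<open>[n] \<rightarrow> [0] \<rightarrow> [1]\<close>.\<close>

definition coface0 :: smap where
  "coface0 = \<lparr>dsrc = 0, dtgt = 1, dfun = (\<lambda>x \<in> {..0}. 1)\<rparr>"

definition to_point :: "nat \<Rightarrow> smap" where
  "to_point n = \<lparr>dsrc = n, dtgt = 0, dfun = (\<lambda>x \<in> {..n}. 0)\<rparr>"

definition d0 :: "('o, 'm) sobj \<Rightarrow> ('o, 'm) sobj \<Rightarrow> (nat \<Rightarrow> smap \<Rightarrow> 'm) \<Rightarrow> ('o, 'm) sarr" where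
  "d0 X T \<iota> = \<lparr>nsrc = X, ntgt = T,
     component = (\<lambda>n \<in> obj Dop. \<iota> n (coface0 \<cdot>\<^bsub>Delta\<^esub> to_point n))\<rparr>"


section \<open>Simplicial descent structures\<close>

text \<open>Coproducts are not chosen: the conditions involving them are required for every choice of
  coproduct. In \<open>S3\<close>, \<open>const_functor Dop (scat D)\<close> is \<open>X \<mapsto> \<Delta> \<times> X\<close> and
  \<open>post Dop D (const_functor Dop D)\<close> is \<open>X \<mapsto> X \<times> \<Delta>\<close>.\<close>

locale simplicial_descent_structure = relative_category_fin_coprod D E
  for D :: "('o, 'm) cat" (structure) and E :: "'m set" +
  fixes s :: "(('o, 'm) sobj, ('o, 'm) sarr, 'o, 'm) func"
    and mu :: "(('o, 'm) bisobj, ('o, 'm) bisarr, 'o, 'm) nt step list"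
    and lam :: "('o, 'm, 'o, 'm) nt step list"
  assumes S1_functor: "is_functor (scat D) D s"
    and S1_coprod: "is_bin_coproduct (scat D) X Y P i j \<Longrightarrow>
      is_bin_coproduct D (omap s X) (omap s Y) Q k l \<Longrightarrow>
      h \<in> hom D Q (omap s P) \<Longrightarrow> h \<cdot> k = amap s i \<Longrightarrow> h \<cdot> l = amap s j \<Longrightarrow> h \<in> E"
    and S2: "we_zigzag (fun_cat (scat (scat D)) D) (objectwise (scat (scat D)) D E)
      (functor_comp (scat (scat D)) s (diag D)) mu (simple_simple D s)"
    and S3: "we_zigzag (fun_cat D D) (objectwise D D E)
      (functor_comp D s (const_functor Dop D)) lam (id_functor D)"
    and S3_left: "loc_arr (fun_cat (scat D) D) (objectwise (scat D) D E) s
        (map (map_step (\<lambda>t. whisker_right (scat D) t (const_functor Dop (scat D)))) mu @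
         map (map_step (\<lambda>t. whisker_right (scat D) t s)) lam) s
      = ident (localization (fun_cat (scat D) D) (objectwise (scat D) D E)) s"
    and S3_right: "loc_arr (fun_cat (scat D) D) (objectwise (scat D) D E) s
        (map (map_step (\<lambda>t. whisker_right (scat D) t (post Dop D (const_functor Dop D)))) mu @
         map (map_step (\<lambda>t. whisker_left (scat D) s (post_nt Dop D t))) lam) s
      = ident (localization (fun_cat (scat D) D) (objectwise (scat D) D E)) s"
    and S4: "f \<in> arr (scat D) \<Longrightarrow> (\<forall>n. component f n \<in> E) \<Longrightarrow> amap s f \<in> E"
    and S5: "A \<in> obj D \<Longrightarrow> is_tensor D (const_ob Dop D A) (std_simplex 1) T \<iota> \<Longrightarrow>
      amap s (d0 (const_ob Dop D A) T \<iota>) \<in> E"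


section \<open>The objectwise structure on functor categories\<close>

text \<open>Let \<open>F : S \<rightarrow> D\<close> be a functor on one of \<open>S = scat D, scat (scat D), D\<close>, and \<open>S'\<close> the same
  construction applied to \<open>fun_cat I D\<close>. The induced functor \<open>S' \<rightarrow> fun_cat I D\<close> sends \<open>X\<close> to
  \<open>i \<mapsto> F (X evaluated at i)\<close>: it is \<open>S' \<rightarrow> fun_cat I S\<close>, moving the variable \<open>i\<close> to the front, followed
  by postcomposition with \<open>F\<close>. The same applies to natural transformations.\<close>

definition objectwise_simple :: "('i, 'j) cat \<Rightarrow> ('o, 'm) cat \<Rightarrow>
    (('o, 'm) sobj, ('o, 'm) sarr, 'o, 'm) func \<Rightarrow>
    ((('i, 'j, 'o, 'm) func, ('i, 'j, 'o, 'm) nt) sobj,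
     (('i, 'j, 'o, 'm) func, ('i, 'j, 'o, 'm) nt) sarr,
     ('i, 'j, 'o, 'm) func, ('i, 'j, 'o, 'm) nt) func" where
  "objectwise_simple I D s =
     functor_comp (scat (fun_cat I D)) (post I (scat D) s) (swap Dop I D)"

definition front2 :: "('i, 'j) cat \<Rightarrow> ('o, 'm) cat \<Rightarrow>
    ((('i, 'j, 'o, 'm) func, ('i, 'j, 'o, 'm) nt) bisobj,
     (('i, 'j, 'o, 'm) func, ('i, 'j, 'o, 'm) nt) bisarr,
     ('i, 'j, ('o, 'm) bisobj, ('o, 'm) bisarr) func,
     ('i, 'j, ('o, 'm) bisobj, ('o, 'm) bisarr) nt) func" where
  "front2 I D = functor_comp (scat (scat (fun_cat I D))) (swap Dop I (scat D))
     (post Dop (scat (fun_cat I D)) (swap Dop I D))"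

definition objectwise_mu :: "('i, 'j) cat \<Rightarrow> ('o, 'm) cat \<Rightarrow>
    (('o, 'm) bisobj, ('o, 'm) bisarr, 'o, 'm) nt step list \<Rightarrow>
    ((('i, 'j, 'o, 'm) func, ('i, 'j, 'o, 'm) nt) bisobj,
     (('i, 'j, 'o, 'm) func, ('i, 'j, 'o, 'm) nt) bisarr,
     ('i, 'j, 'o, 'm) func, ('i, 'j, 'o, 'm) nt) nt step list" where
  "objectwise_mu I D mu = map (map_step (\<lambda>t.
     whisker_right (scat (scat (fun_cat I D))) (post_nt I (scat (scat D)) t) (front2 I D))) mu"

definition objectwise_lambda :: "('i, 'j) cat \<Rightarrow> ('o, 'm) cat \<Rightarrow>
    ('o, 'm, 'o, 'm) nt step list \<Rightarrow>
    (('i, 'j, 'o, 'm) func, ('i, 'j, 'o, 'm) nt,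
     ('i, 'j, 'o, 'm) func, ('i, 'j, 'o, 'm) nt) nt step list" where
  "objectwise_lambda I D lam = map (map_step (post_nt I D)) lam"

end

theory Submission
  imports Defs
begin

text \<open>All the conditions are checked objectwise, and the proof has three ingredients.

First, extension to functor categories is a strict 2-functorial construction. For a functor
\<open>K : S' \<rightarrow> Fun(I,S)\<close>, the extension of \<open>F : S \<rightarrow> D\<close> along \<open>K\<close> is \<open>Fun(I,F) \<circ> K : S' \<rightarrow> Fun(I,D)\<close>, and
similarly for transformations. The simple functor, \<open>\<mu>\<close> and \<open>\<lambda>\<close> on \<open>Fun(I,D)\<close> are extensions of the
given ones, along the functors that move the variable in \<open>I\<close> in front of the simplicial variables
(the identity, in the case of \<open>\<lambda>\<close>). Extensions of composites
and of whiskerings are again composites and whiskerings of extensions, by \<open>lift_functor_comp\<close> and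
\<open>lift_whisker_right\<close>, as soon as the functors involved (diagonal, constant functors, the simple functor
applied in the inner variable) commute with the exchange of variables; this is the content of
\<open>swap_post\<close>, \<open>swap_post_nt\<close>, \<open>swap_const\<close> and \<open>front2_diag\<close>. Hence the source and target of the extended
zigzags are the required ones, and the two zigzags in the compatibility of \<open>\<lambda>\<close> with \<open>\<mu>\<close> over \<open>Fun(I,D)\<close>
are, arrow by arrow, the extensions of the two zigzags over \<open>D\<close>.

Second, a functor that preserves weak equivalences acts on zigzags and respects the congruence that
defines the localization (\<open>weq_functor.map_loc_eq\<close>). Extension along \<open>K\<close> is such a functor
(\<open>weq_functor_lift\<close>), so it carries the compatibility of \<open>\<lambda>\<close> with \<open>\<mu>\<close> from \<open>D\<close> to \<open>Fun(I,D)\<close>. Evaluation at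
an object of \<open>I\<close> is another such functor, which gives the saturation of the class of objectwise weak
equivalences (\<open>saturated_objectwise\<close>).

Third, as \<open>D\<close> has finite coproducts, every finite coproduct in a functor category is computed
objectwise (\<open>coproduct_eval\<close>, \<open>coproduct_slice\<close>). So evaluation at an object of \<open>I\<close> takes the coproducts
and tensors in the conditions for \<open>Fun(I,D)\<close> to coproducts and tensors in \<open>D\<close>, where the hypotheses
apply.\<close>

section \<open>Categories and functors\<close>

lemma cmp_arr:
  assumes "category C" "f \<in> arr C" "g \<in> arr C" "tgt C f = src C g"
  shows "g \<cdot>\<^bsub>C\<^esub> f \<in> arr C" "src C (g \<cdot>\<^bsub>C\<^esub> f) = src C f" "tgt C (g \<cdot>\<^bsub>C\<^esub> f) = tgt C g"
  using category.cmp_hom[OF assms(1), of f "src C f" "tgt C f" g "tgt C g"] assms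
  by (auto simp: hom_def)

lemma ident_arr:
  assumes "category C" "a \<in> obj C"
  shows "ident C a \<in> arr C" "src C (ident C a) = a" "tgt C (ident C a) = a"
  using category.ident_hom[OF assms] by (auto simp: hom_def)

lemma cmp_assoc_arr:
  assumes "category C" "f \<in> arr C" "g \<in> arr C" "h \<in> arr C" "tgt C f = src C g" "tgt C g = src C h"
  shows "(h \<cdot>\<^bsub>C\<^esub> g) \<cdot>\<^bsub>C\<^esub> f = h \<cdot>\<^bsub>C\<^esub> (g \<cdot>\<^bsub>C\<^esub> f)"
  by (rule category.cmp_assoc[OF assms(1)]) (use assms in \<open>auto simp: hom_def\<close>)

lemma cmp_ident_arr:
  assumes "category C" "f \<in> arr C"
  shows "src C f = a \<Longrightarrow> f \<cdot>\<^bsub>C\<^esub> ident C a = f" "tgt C f = b \<Longrightarrow> ident C b \<cdot>\<^bsub>C\<^esub> f = f"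
  using category.cmp_ident_left[OF assms(1)] category.cmp_ident_right[OF assms(1)] assms
  by (auto simp: hom_def)

lemma category_op_cat:
  assumes "category C"
  shows "category (op_cat C)"
proof -
  interpret category C by fact
  show ?thesis
    by unfold_locales
      (use src_obj tgt_obj ident_hom cmp_hom cmp_ident_left cmp_ident_right cmp_assoc in
        \<open>auto simp: op_cat_def hom_def\<close>)
qed

lemma functorI:
  assumes "omap F \<in> extensional (obj A)" "amap F \<in> extensional (arr A)"
    and "\<And>a. a \<in> obj A \<Longrightarrow> omap F a \<in> obj B"
    and "\<And>f. f \<in> arr A \<Longrightarrow> amap F f \<in> arr B"
    and "\<And>f. f \<in> arr A \<Longrightarrow> src B (amap F f) = omap F (src A f)"
    and "\<And>f. f \<in> arr A \<Longrightarrow> tgt B (amap F f) = omap F (tgt A f)"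
    and "\<And>a. a \<in> obj A \<Longrightarrow> amap F (ident A a) = ident B (omap F a)"
    and "\<And>f g. f \<in> arr A \<Longrightarrow> g \<in> arr A \<Longrightarrow> tgt A f = src A g \<Longrightarrow>
           amap F (g \<cdot>\<^bsub>A\<^esub> f) = amap F g \<cdot>\<^bsub>B\<^esub> amap F f"
  shows "is_functor A B F"
  using assms by (auto simp: is_functor_def hom_def PiE_def)

lemma functorD:
  assumes "is_functor A B F"
  shows "omap F \<in> extensional (obj A)" "amap F \<in> extensional (arr A)"
    and "a \<in> obj A \<Longrightarrow> omap F a \<in> obj B"
    and "f \<in> arr A \<Longrightarrow> amap F f \<in> arr B"
    and "f \<in> arr A \<Longrightarrow> src B (amap F f) = omap F (src A f)"
    and "f \<in> arr A \<Longrightarrow> tgt B (amap F f) = omap F (tgt A f)"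
    and "a \<in> obj A \<Longrightarrow> amap F (ident A a) = ident B (omap F a)"
    and "f \<in> arr A \<Longrightarrow> g \<in> arr A \<Longrightarrow> tgt A f = src A g \<Longrightarrow>
           amap F (g \<cdot>\<^bsub>A\<^esub> f) = amap F g \<cdot>\<^bsub>B\<^esub> amap F f"
  using assms by (auto simp: is_functor_def hom_def PiE_def)

lemma functor_eqI:
  fixes F G :: "('o, 'm, 'p, 'n) func"
  assumes "is_functor A B F" "is_functor A B' G"
    and "\<And>a. a \<in> obj A \<Longrightarrow> omap F a = omap G a"
    and "\<And>f. f \<in> arr A \<Longrightarrow> amap F f = amap G f"
  shows "F = G"
proof (rule func.equality)
  show "omap F = omap G"
    using functorD(1)[OF assms(1)] functorD(1)[OF assms(2)] assms(3) by (rule extensionalityI)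
  show "amap F = amap G"
    using functorD(2)[OF assms(1)] functorD(2)[OF assms(2)] assms(4) by (rule extensionalityI)
qed simp

lemma ntI:
  assumes "is_functor A B (nsrc t)" "is_functor A B (ntgt t)" "component t \<in> extensional (obj A)"
    and "\<And>a. a \<in> obj A \<Longrightarrow> component t a \<in> arr B"
    and "\<And>a. a \<in> obj A \<Longrightarrow> src B (component t a) = omap (nsrc t) a"
    and "\<And>a. a \<in> obj A \<Longrightarrow> tgt B (component t a) = omap (ntgt t) a"
    and "\<And>f. f \<in> arr A \<Longrightarrow> component t (tgt A f) \<cdot>\<^bsub>B\<^esub> amap (nsrc t) f
            = amap (ntgt t) f \<cdot>\<^bsub>B\<^esub> component t (src A f)"
  shows "is_nt A B t"
  using assms by (auto simp: is_nt_def hom_def)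

lemma ntD:
  assumes "is_nt A B t"
  shows "is_functor A B (nsrc t)" "is_functor A B (ntgt t)" "component t \<in> extensional (obj A)"
    and "a \<in> obj A \<Longrightarrow> component t a \<in> arr B"
    and "a \<in> obj A \<Longrightarrow> src B (component t a) = omap (nsrc t) a"
    and "a \<in> obj A \<Longrightarrow> tgt B (component t a) = omap (ntgt t) a"
    and "f \<in> arr A \<Longrightarrow> component t (tgt A f) \<cdot>\<^bsub>B\<^esub> amap (nsrc t) f
            = amap (ntgt t) f \<cdot>\<^bsub>B\<^esub> component t (src A f)"
  using assms by (auto simp: is_nt_def hom_def)

lemma nt_eqI:
  fixes t u :: "('o, 'm, 'p, 'n) nt"
  assumes "nsrc t = nsrc u" "ntgt t = ntgt u"
    and "component t \<in> extensional S" "component u \<in> extensional S"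
    and "\<And>a. a \<in> S \<Longrightarrow> component t a = component u a"
  shows "t = u"
  by (rule nt.equality) (use assms extensionalityI in \<open>auto\<close>)

lemma fun_cat_simps [simp]:
  "F \<in> obj (fun_cat A B) \<longleftrightarrow> is_functor A B F"
  "t \<in> arr (fun_cat A B) \<longleftrightarrow> is_nt A B t"
  "src (fun_cat A B) = nsrc"
  "tgt (fun_cat A B) = ntgt"
  by (simp_all add: fun_cat_def)

lemma fun_cat_ident [simp]:
  "nsrc (ident (fun_cat A B) F) = F"
  "ntgt (ident (fun_cat A B) F) = F"
  "component (ident (fun_cat A B) F) \<in> extensional (obj A)"
  "a \<in> obj A \<Longrightarrow> component (ident (fun_cat A B) F) a = ident B (omap F a)"
  by (simp_all add: fun_cat_def)

lemma fun_cat_cmp [simp]: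
  "nsrc (t \<cdot>\<^bsub>fun_cat A B\<^esub> u) = nsrc u"
  "ntgt (t \<cdot>\<^bsub>fun_cat A B\<^esub> u) = ntgt t"
  "component (t \<cdot>\<^bsub>fun_cat A B\<^esub> u) \<in> extensional (obj A)"
  "a \<in> obj A \<Longrightarrow> component (t \<cdot>\<^bsub>fun_cat A B\<^esub> u) a = component t a \<cdot>\<^bsub>B\<^esub> component u a"
  by (simp_all add: fun_cat_def)

lemma nt_ident:
  assumes "category A" "category B" "is_functor A B F"
  shows "is_nt A B (ident (fun_cat A B) F)"
  by (rule ntI)
    (use assms in \<open>auto simp: functorD ident_arr cmp_ident_arr category.src_obj category.tgt_obj\<close>)

lemma nt_cmp:
  assumes A: "category A" and B: "category B" and t: "is_nt A B t" and u: "is_nt A B u"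
    and tu: "ntgt u = nsrc t"
  shows "is_nt A B (t \<cdot>\<^bsub>fun_cat A B\<^esub> u)"
proof (rule ntI)
  fix f assume f: "f \<in> arr A"
  note [simp] = category.src_obj[OF A f] category.tgt_obj[OF A f]
  note facts = f t u tu ntD[OF t] ntD[OF u] functorD[OF ntD(1)[OF t]] functorD[OF ntD(2)[OF t]]
    functorD[OF ntD(1)[OF u]]
  let ?a = "src A f" and ?b = "tgt A f"
  have "(component t ?b \<cdot>\<^bsub>B\<^esub> component u ?b) \<cdot>\<^bsub>B\<^esub> amap (nsrc u) f
      = component t ?b \<cdot>\<^bsub>B\<^esub> (component u ?b \<cdot>\<^bsub>B\<^esub> amap (nsrc u) f)"
    by (rule cmp_assoc_arr[OF B]) (use facts in auto)
  also have "\<dots> = component t ?b \<cdot>\<^bsub>B\<^esub> (amap (nsrc t) f \<cdot>\<^bsub>B\<^esub> component u ?a)"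
    using facts by simp
  also have "\<dots> = (component t ?b \<cdot>\<^bsub>B\<^esub> amap (nsrc t) f) \<cdot>\<^bsub>B\<^esub> component u ?a"
    by (rule cmp_assoc_arr[OF B, symmetric]) (use facts in auto)
  also have "\<dots> = (amap (ntgt t) f \<cdot>\<^bsub>B\<^esub> component t ?a) \<cdot>\<^bsub>B\<^esub> component u ?a"
    using facts by simp
  also have "\<dots> = amap (ntgt t) f \<cdot>\<^bsub>B\<^esub> (component t ?a \<cdot>\<^bsub>B\<^esub> component u ?a)"
    by (rule cmp_assoc_arr[OF B]) (use facts in auto)
  finally show "component (t \<cdot>\<^bsub>fun_cat A B\<^esub> u) (tgt A f) \<cdot>\<^bsub>B\<^esub> amap (nsrc (t \<cdot>\<^bsub>fun_cat A B\<^esub> u)) f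
      = amap (ntgt (t \<cdot>\<^bsub>fun_cat A B\<^esub> u)) f \<cdot>\<^bsub>B\<^esub> component (t \<cdot>\<^bsub>fun_cat A B\<^esub> u) (src A f)"
    by simp
qed (use ntD[OF t] ntD[OF u] tu in \<open>auto simp: cmp_arr[OF B]\<close>)

lemma category_fun_cat:
  assumes A: "category A" and B: "category B"
  shows "category (fun_cat A B)"
proof
  fix t F G
  assume "t \<in> hom (fun_cat A B) F G"
  then have t: "is_nt A B t" "nsrc t = F" "ntgt t = G" by (auto simp: hom_def)
  show "ident (fun_cat A B) G \<cdot>\<^bsub>fun_cat A B\<^esub> t = t"
    by (rule nt_eqI[where S = "obj A"]) (use t ntD[OF t(1)] in \<open>auto simp: cmp_ident_arr[OF B]\<close>)
  show "t \<cdot>\<^bsub>fun_cat A B\<^esub> ident (fun_cat A B) F = t"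
    by (rule nt_eqI[where S = "obj A"]) (use t ntD[OF t(1)] in \<open>auto simp: cmp_ident_arr[OF B]\<close>)
next
  fix t u v F F' G G'
  assume "t \<in> hom (fun_cat A B) F F'" "u \<in> hom (fun_cat A B) F' G" "v \<in> hom (fun_cat A B) G G'"
  then have t: "is_nt A B t" "nsrc t = F" "ntgt t = F'"
    and u: "is_nt A B u" "nsrc u = F'" "ntgt u = G"
    and v: "is_nt A B v" "nsrc v = G" "ntgt v = G'" by (auto simp: hom_def)
  show "(v \<cdot>\<^bsub>fun_cat A B\<^esub> u) \<cdot>\<^bsub>fun_cat A B\<^esub> t = v \<cdot>\<^bsub>fun_cat A B\<^esub> (u \<cdot>\<^bsub>fun_cat A B\<^esub> t)"
    by (rule nt_eqI[where S = "obj A"])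
      (use t u v ntD[OF t(1)] ntD[OF u(1)] ntD[OF v(1)] in \<open>auto intro!: cmp_assoc_arr[OF B]\<close>)
qed (auto simp: hom_def ntD nt_ident nt_cmp A B)

text \<open>A functor into \<open>Fun(B,C)\<close> is determined by its values at pairs of an object and an object, an object
and an arrow, and an arrow and an object. The second lemma is the same for \<open>Fun(B, Fun(C,D))\<close>.\<close>

lemma functor_fun_cat_eqI:
  assumes A: "category A" and F: "is_functor A (fun_cat B C) F" and G: "is_functor A (fun_cat B C) G"
    and o: "\<And>a b. a \<in> obj A \<Longrightarrow> b \<in> obj B \<Longrightarrow> omap (omap F a) b = omap (omap G a) b"
    and m: "\<And>a g. a \<in> obj A \<Longrightarrow> g \<in> arr B \<Longrightarrow> amap (omap F a) g = amap (omap G a) g"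
    and n: "\<And>f b. f \<in> arr A \<Longrightarrow> b \<in> obj B \<Longrightarrow> component (amap F f) b = component (amap G f) b"
  shows "F = G"
proof (rule functor_eqI[OF F G])
  fix a assume a: "a \<in> obj A"
  show *: "omap F a = omap G a"
    by (rule functor_eqI[where A = B and B = C and B' = C])
      (use functorD(3)[OF F a] functorD(3)[OF G a] o m a in auto)
next
  fix f assume f: "f \<in> arr A"
  have *: "omap F a = omap G a" if a: "a \<in> obj A" for a
    by (rule functor_eqI[where A = B and B = C and B' = C])
      (use functorD(3)[OF F a] functorD(3)[OF G a] o m a in auto)
  have ex: "is_nt B C (amap F f)" "is_nt B C (amap G f)"
    using functorD(4)[OF F f] functorD(4)[OF G f] by auto
  show "amap F f = amap G f"
    by (rule nt_eqI[where S = "obj B"])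
      (use functorD(5,6)[OF F f] functorD(5,6)[OF G f] f n ntD(3)[OF ex(1)] ntD(3)[OF ex(2)]
        category.src_obj[OF A] category.tgt_obj[OF A] in \<open>auto simp: *\<close>)
qed

lemma functor_fun_cat2_eqI:
  assumes A: "category A" and B: "category B"
    and F: "is_functor A (fun_cat B (fun_cat C D)) F" and G: "is_functor A (fun_cat B (fun_cat C D)) G"
    and oo: "\<And>a b c. a \<in> obj A \<Longrightarrow> b \<in> obj B \<Longrightarrow> c \<in> obj C \<Longrightarrow>
      omap (omap (omap F a) b) c = omap (omap (omap G a) b) c"
    and om: "\<And>a b h. a \<in> obj A \<Longrightarrow> b \<in> obj B \<Longrightarrow> h \<in> arr C \<Longrightarrow>
      amap (omap (omap F a) b) h = amap (omap (omap G a) b) h"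
    and mo: "\<And>a g c. a \<in> obj A \<Longrightarrow> g \<in> arr B \<Longrightarrow> c \<in> obj C \<Longrightarrow>
      component (amap (omap F a) g) c = component (amap (omap G a) g) c"
    and n: "\<And>f b c. f \<in> arr A \<Longrightarrow> b \<in> obj B \<Longrightarrow> c \<in> obj C \<Longrightarrow>
      component (component (amap F f) b) c = component (component (amap G f) b) c"
  shows "F = G"
proof (rule functor_eqI[OF F G])
  have o: "omap F a = omap G a" if a: "a \<in> obj A" for a
    by (rule functor_fun_cat_eqI[OF B])
      (use functorD(3)[OF F a] functorD(3)[OF G a] oo om mo a in auto)
  then show "omap F a = omap G a" if "a \<in> obj A" for a using that by simp
  fix f assume f: "f \<in> arr A"
  have nt: "is_nt B (fun_cat C D) (amap F f)" "is_nt B (fun_cat C D) (amap G f)"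
    using functorD(4)[OF F f] functorD(4)[OF G f] by auto
  have st: "nsrc (amap F f) = nsrc (amap G f)" "ntgt (amap F f) = ntgt (amap G f)"
    using functorD(5,6)[OF F f] functorD(5,6)[OF G f] o
      category.src_obj[OF A f] category.tgt_obj[OF A f] by auto
  show "amap F f = amap G f"
  proof (rule nt_eqI[OF st ntD(3)[OF nt(1)] ntD(3)[OF nt(2)]])
    fix b assume b: "b \<in> obj B"
    show "component (amap F f) b = component (amap G f) b"
      by (rule nt_eqI[where S = "obj C"])
        (use ntD(4-6)[OF nt(1) b] ntD(4-6)[OF nt(2) b] st n f b in \<open>auto dest: ntD(3)\<close>)
  qed
qed

section \<open>Composition and whiskering\<close>

lemma functor_comp_simps [simp]:
  "a \<in> obj A \<Longrightarrow> omap (functor_comp A G F) a = omap G (omap F a)"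
  "f \<in> arr A \<Longrightarrow> amap (functor_comp A G F) f = amap G (amap F f)"
  by (simp_all add: functor_comp_def compose_def)

lemma functor_functor_comp:
  assumes A: "category A" and F: "is_functor A B F" and G: "is_functor B C G"
  shows "is_functor A C (functor_comp A G F)"
  by (rule functorI)
    (auto simp: functorD[OF F] functorD[OF G] category.src_obj[OF A] category.tgt_obj[OF A]
      ident_arr[OF A] cmp_arr[OF A], auto simp: functor_comp_def compose_def)

text \<open>Nothing is assumed on \<open>G\<close> and \<open>H\<close>: both sides are restricted to \<open>A\<close>, and \<open>F\<close> takes its values in \<open>B\<close>.\<close>

lemma functor_comp_assoc:
  assumes F: "is_functor A B F"
  shows "functor_comp A (functor_comp B H G) F = functor_comp A H (functor_comp A G F)"
  by (rule func.equality) (auto simp: functor_comp_def compose_def fun_eq_iff functorD[OF F])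

lemma id_functor_simps [simp]:
  "a \<in> obj A \<Longrightarrow> omap (id_functor A) a = a"
  "f \<in> arr A \<Longrightarrow> amap (id_functor A) f = f"
  by (simp_all add: id_functor_def)

lemma functor_id_functor:
  assumes "category A"
  shows "is_functor A A (id_functor A)"
  by (rule functorI)
    (use assms in \<open>auto simp: category.src_obj category.tgt_obj ident_arr cmp_arr\<close>,
      auto simp: id_functor_def)

lemma functor_comp_id:
  assumes "is_functor A B F"
  shows "functor_comp A F (id_functor A) = F"
  by (rule func.equality)
    (auto simp: functor_comp_def compose_def id_functor_def fun_eq_iff
      extensional_arb[OF functorD(1)[OF assms]] extensional_arb[OF functorD(2)[OF assms]])

lemma whisker_right_simps [simp]:
  "nsrc (whisker_right A t H) = functor_comp A (nsrc t) H"
  "ntgt (whisker_right A t H) = functor_comp A (ntgt t) H"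
  "component (whisker_right A t H) \<in> extensional (obj A)"
  "a \<in> obj A \<Longrightarrow> component (whisker_right A t H) a = component t (omap H a)"
  by (simp_all add: whisker_right_def)

lemma whisker_left_simps [simp]:
  "nsrc (whisker_left A K t) = functor_comp A K (nsrc t)"
  "ntgt (whisker_left A K t) = functor_comp A K (ntgt t)"
  "component (whisker_left A K t) \<in> extensional (obj A)"
  "a \<in> obj A \<Longrightarrow> component (whisker_left A K t) a = amap K (component t a)"
  by (simp_all add: whisker_left_def)

lemma nt_whisker_right:
  assumes A: "category A" and H: "is_functor A B H" and t: "is_nt B C t"
  shows "is_nt A C (whisker_right A t H)"
proof (rule ntI)
  fix f assume f: "f \<in> arr A"
  show "component (whisker_right A t H) (tgt A f) \<cdot>\<^bsub>C\<^esub> amap (nsrc (whisker_right A t H)) f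
      = amap (ntgt (whisker_right A t H)) f \<cdot>\<^bsub>C\<^esub> component (whisker_right A t H) (src A f)"
    using ntD(7)[OF t functorD(4)[OF H f]] f
    by (simp add: functorD[OF H] category.src_obj[OF A] category.tgt_obj[OF A])
qed (use ntD[OF t] functorD[OF H] in \<open>auto intro: functor_functor_comp[OF A H]\<close>)

lemma nt_whisker_left:
  assumes A: "category A" and t: "is_nt A B t" and K: "is_functor B C K"
  shows "is_nt A C (whisker_left A K t)"
proof (rule ntI)
  fix f assume f: "f \<in> arr A"
  note facts = ntD[OF t] functorD(4-6)[OF ntD(1)[OF t] f] functorD(4-6)[OF ntD(2)[OF t] f]
    category.src_obj[OF A f] category.tgt_obj[OF A f] f
  have "amap K (component t (tgt A f) \<cdot>\<^bsub>B\<^esub> amap (nsrc t) f)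
      = amap K (amap (ntgt t) f \<cdot>\<^bsub>B\<^esub> component t (src A f))"
    using ntD(7)[OF t f] by simp
  then show "component (whisker_left A K t) (tgt A f) \<cdot>\<^bsub>C\<^esub> amap (nsrc (whisker_left A K t)) f
      = amap (ntgt (whisker_left A K t)) f \<cdot>\<^bsub>C\<^esub> component (whisker_left A K t) (src A f)"
    using functorD(8)[OF K, of "amap (nsrc t) f" "component t (tgt A f)"]
      functorD(8)[OF K, of "component t (src A f)" "amap (ntgt t) f"] by (simp add: facts)
qed (use ntD[OF t] functorD[OF K] in \<open>auto intro: functor_functor_comp[OF A _ K]\<close>)

lemma whisker_right_comp:
  assumes "is_functor A B F"
  shows "whisker_right A (whisker_right B t G) F = whisker_right A t (functor_comp A G F)"
  by (rule nt_eqI[where S = "obj A"])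
    (auto simp: functorD[OF assms] functor_comp_assoc[OF assms])

lemma whisker_left_comp:
  assumes t: "is_nt A B t"
  shows "whisker_left A (functor_comp B H G) t = whisker_left A H (whisker_left A G t)"
  by (rule nt_eqI[where S = "obj A"])
    (auto simp: ntD[OF t] functor_comp_assoc[OF ntD(1)[OF t]] functor_comp_assoc[OF ntD(2)[OF t]])

lemma whisker_left_right:
  assumes F: "is_functor A B F"
  shows "whisker_right A (whisker_left B K t) F = whisker_left A K (whisker_right A t F)"
  by (rule nt_eqI[where S = "obj A"]) (auto simp: functorD[OF F] functor_comp_assoc[OF F])

lemma post_simps [simp]:
  "is_functor A B X \<Longrightarrow> omap (post A B F) X = functor_comp A F X"
  "is_nt A B t \<Longrightarrow> amap (post A B F) t = whisker_left A F t"
  by (simp_all add: post_def)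

lemma post_nt_simps [simp]:
  "nsrc (post_nt A B t) = post A B (nsrc t)"
  "ntgt (post_nt A B t) = post A B (ntgt t)"
  "component (post_nt A B t) \<in> extensional (obj (fun_cat A B))"
  "is_functor A B X \<Longrightarrow> component (post_nt A B t) X = whisker_right A t X"
  by (simp_all add: post_nt_def)

lemma functor_post:
  assumes A: "category A" and B: "category B" and F: "is_functor B C F"
  shows "is_functor (fun_cat A B) (fun_cat A C) (post A B F)"
proof (rule functorI)
  show "omap (post A B F) \<in> extensional (obj (fun_cat A B))"
    "amap (post A B F) \<in> extensional (arr (fun_cat A B))"
    by (simp_all add: post_def del: fun_cat_simps)
next
  fix X assume "X \<in> obj (fun_cat A B)"
  then have X: "is_functor A B X" by simp
  show "omap (post A B F) X \<in> obj (fun_cat A C)"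
    using X functor_functor_comp[OF A X F] by simp
  show "amap (post A B F) (ident (fun_cat A B) X) = ident (fun_cat A C) (omap (post A B F) X)"
    by (rule nt_eqI[where S = "obj A"])
      (auto simp: X nt_ident[OF A B] functorD[OF F] functorD[OF X])
next
  fix t assume "t \<in> arr (fun_cat A B)"
  then have t: "is_nt A B t" by simp
  show "amap (post A B F) t \<in> arr (fun_cat A C)"
    "src (fun_cat A C) (amap (post A B F) t) = omap (post A B F) (src (fun_cat A B) t)"
    "tgt (fun_cat A C) (amap (post A B F) t) = omap (post A B F) (tgt (fun_cat A B) t)"
    using t nt_whisker_left[OF A t F] ntD[OF t] by simp_all
next
  fix t u assume "t \<in> arr (fun_cat A B)" "u \<in> arr (fun_cat A B)" "tgt (fun_cat A B) t = src (fun_cat A B) u"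
  then have t: "is_nt A B t" and u: "is_nt A B u" and tu: "ntgt t = nsrc u" by auto
  show "amap (post A B F) (u \<cdot>\<^bsub>fun_cat A B\<^esub> t) = amap (post A B F) u \<cdot>\<^bsub>fun_cat A C\<^esub> amap (post A B F) t"
    by (rule nt_eqI[where S = "obj A"])
      (use t u tu ntD[OF t] ntD[OF u] in \<open>auto simp: nt_cmp[OF A B] functorD[OF F]\<close>)
qed

lemma nt_post_nt:
  assumes A: "category A" and B: "category B" and t: "is_nt B C t"
  shows "is_nt (fun_cat A B) (fun_cat A C) (post_nt A B t)"
proof (rule ntI)
  fix u assume "u \<in> arr (fun_cat A B)"
  then have u: "is_nt A B u" by simp
  show "component (post_nt A B t) (tgt (fun_cat A B) u) \<cdot>\<^bsub>fun_cat A C\<^esub> amap (nsrc (post_nt A B t)) u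
      = amap (ntgt (post_nt A B t)) u \<cdot>\<^bsub>fun_cat A C\<^esub> component (post_nt A B t) (src (fun_cat A B) u)"
    by (rule nt_eqI[where S = "obj A"])
      (use ntD[OF u] ntD(7)[OF t ntD(4)[OF u]] u in auto)
qed (auto simp: functor_post[OF A B] ntD[OF t] nt_whisker_right[OF A _ t])

text \<open>Postcomposition is a strict 2-functor: it preserves composites and identities of functors, both
  whiskerings, and vertical composites and identities of transformations.\<close>

lemma post_comp:
  assumes A: "category A" and B: "category B" and C: "category C" and F: "is_functor B C F" and G: "is_functor C E G"
  shows "post A B (functor_comp B G F) = functor_comp (fun_cat A B) (post A C G) (post A B F)"
proof (rule functor_eqI)
  show "is_functor (fun_cat A B) (fun_cat A E) (post A B (functor_comp B G F))"
    by (rule functor_post[OF A B functor_functor_comp[OF B F G]])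
next
  fix X assume "X \<in> obj (fun_cat A B)"
  then have X: "is_functor A B X" by simp
  show "omap (post A B (functor_comp B G F)) X
      = omap (functor_comp (fun_cat A B) (post A C G) (post A B F)) X"
    by (simp add: X functor_functor_comp[OF A X F] functor_comp_assoc[OF X])
next
  fix t assume "t \<in> arr (fun_cat A B)"
  then have t: "is_nt A B t" by simp
  show "amap (post A B (functor_comp B G F)) t
      = amap (functor_comp (fun_cat A B) (post A C G) (post A B F)) t"
    by (simp add: t nt_whisker_left[OF A t F] whisker_left_comp[OF t])
qed (rule functor_functor_comp[OF category_fun_cat[OF A B] functor_post[OF A B F]
      functor_post[OF A C G]])

lemma post_id_functor:
  assumes A: "category A" and B: "category B"
  shows "post A B (id_functor B) = id_functor (fun_cat A B)"
proof (rule functor_fun_cat_eqI)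
  show "is_functor (fun_cat A B) (fun_cat A B) (post A B (id_functor B))"
    by (rule functor_post[OF A B functor_id_functor[OF B]])
  show "is_functor (fun_cat A B) (fun_cat A B) (id_functor (fun_cat A B))"
    by (rule functor_id_functor[OF category_fun_cat[OF A B]])
qed (auto simp: category_fun_cat[OF A B] functorD ntD)

lemma post_nt_whisker_right:
  assumes A: "category A" and B: "category B" and C: "category C"
    and F: "is_functor B C F" and t: "is_nt C E t"
  shows "post_nt A B (whisker_right B t F) = whisker_right (fun_cat A B) (post_nt A C t) (post A B F)"
proof (rule nt_eqI[where S = "obj (fun_cat A B)"])
  fix X assume "X \<in> obj (fun_cat A B)"
  then have X: "is_functor A B X" by simp
  show "component (post_nt A B (whisker_right B t F)) X
      = component (whisker_right (fun_cat A B) (post_nt A C t) (post A B F)) X"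
    by (simp add: X functor_functor_comp[OF A X F] whisker_right_comp[OF X])
qed (simp_all add: post_comp[OF A B C F ntD(1)[OF t]] post_comp[OF A B C F ntD(2)[OF t]]
    del: fun_cat_simps)

lemma post_nt_whisker_left:
  assumes A: "category A" and B: "category B" and C: "category C"
    and t: "is_nt B C t" and K: "is_functor C E K"
  shows "post_nt A B (whisker_left B K t) = whisker_left (fun_cat A B) (post A C K) (post_nt A B t)"
proof (rule nt_eqI[where S = "obj (fun_cat A B)"])
  fix X assume "X \<in> obj (fun_cat A B)"
  then have X: "is_functor A B X" by simp
  show "component (post_nt A B (whisker_left B K t)) X
      = component (whisker_left (fun_cat A B) (post A C K) (post_nt A B t)) X"
    by (simp add: X nt_whisker_right[OF A X t] whisker_left_right[OF X])
qed (simp_all add: post_comp[OF A B C ntD(1)[OF t] K] post_comp[OF A B C ntD(2)[OF t] K]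
    del: fun_cat_simps)

lemma post_nt_ident:
  assumes A: "category A" and B: "category B" and F: "is_functor B C F"
  shows "post_nt A B (ident (fun_cat B C) F)
    = ident (fun_cat (fun_cat A B) (fun_cat A C)) (post A B F)"
proof (rule nt_eqI[where S = "obj (fun_cat A B)"])
  fix X assume "X \<in> obj (fun_cat A B)"
  then have X: "is_functor A B X" by simp
  show "component (post_nt A B (ident (fun_cat B C) F)) X
      = component (ident (fun_cat (fun_cat A B) (fun_cat A C)) (post A B F)) X"
    by (rule nt_eqI[where S = "obj A"]) (simp_all add: X functorD[OF X])
qed (simp_all del: fun_cat_simps)

lemma post_nt_cmp:
  assumes A: "category A" and B: "category B" and t: "is_nt B C t" and u: "is_nt B C u"
    and tu: "ntgt u = nsrc t"
  shows "post_nt A B (t \<cdot>\<^bsub>fun_cat B C\<^esub> u)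
    = post_nt A B t \<cdot>\<^bsub>fun_cat (fun_cat A B) (fun_cat A C)\<^esub> post_nt A B u"
proof (rule nt_eqI[where S = "obj (fun_cat A B)"])
  fix X assume "X \<in> obj (fun_cat A B)"
  then have X: "is_functor A B X" by simp
  show "component (post_nt A B (t \<cdot>\<^bsub>fun_cat B C\<^esub> u)) X
      = component (post_nt A B t \<cdot>\<^bsub>fun_cat (fun_cat A B) (fun_cat A C)\<^esub> post_nt A B u) X"
    by (rule nt_eqI[where S = "obj A"]) (simp_all add: X functorD[OF X])
qed (simp_all del: fun_cat_simps)

section \<open>Constant functors and exchange of variables\<close>

lemma const_ob_simps [simp]:
  "a \<in> obj A \<Longrightarrow> omap (const_ob A B b) a = b"
  "f \<in> arr A \<Longrightarrow> amap (const_ob A B b) f = ident B b"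
  by (simp_all add: const_ob_def)

lemma const_functor_simps [simp]:
  "b \<in> obj B \<Longrightarrow> omap (const_functor A B) b = const_ob A B b"
  "g \<in> arr B \<Longrightarrow> nsrc (amap (const_functor A B) g) = const_ob A B (src B g)"
  "g \<in> arr B \<Longrightarrow> ntgt (amap (const_functor A B) g) = const_ob A B (tgt B g)"
  "g \<in> arr B \<Longrightarrow> component (amap (const_functor A B) g) \<in> extensional (obj A)"
  "g \<in> arr B \<Longrightarrow> a \<in> obj A \<Longrightarrow> component (amap (const_functor A B) g) a = g"
  by (simp_all add: const_functor_def)

lemma functor_const_ob:
  assumes A: "category A" and B: "category B" and b: "b \<in> obj B"
  shows "is_functor A B (const_ob A B b)"
  by (rule functorI)
    (auto simp: b category.src_obj[OF A] category.tgt_obj[OF A] ident_arr[OF A] ident_arr[OF B b]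
      cmp_arr[OF A] cmp_ident_arr[OF B], auto simp: const_ob_def)

lemma functor_const_functor:
  assumes A: "category A" and B: "category B"
  shows "is_functor B (fun_cat A B) (const_functor A B)"
proof (rule functorI)
  fix g assume g: "g \<in> arr B"
  have "is_nt A B (amap (const_functor A B) g)"
    by (rule ntI) (use g in \<open>auto simp: category.src_obj[OF A] category.tgt_obj[OF A]
      category.src_obj[OF B] category.tgt_obj[OF B] functor_const_ob[OF A B] cmp_ident_arr[OF B]\<close>)
  then show "amap (const_functor A B) g \<in> arr (fun_cat A B)" by simp
next
  fix b assume b: "b \<in> obj B"
  show "amap (const_functor A B) (ident B b) = ident (fun_cat A B) (omap (const_functor A B) b)"
    by (rule nt_eqI[where S = "obj A"]) (use b in \<open>auto simp: ident_arr[OF B]\<close>)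
next
  fix f g assume "f \<in> arr B" "g \<in> arr B" "tgt B f = src B g"
  then show "amap (const_functor A B) (g \<cdot>\<^bsub>B\<^esub> f)
      = amap (const_functor A B) g \<cdot>\<^bsub>fun_cat A B\<^esub> amap (const_functor A B) f"
    by (intro nt_eqI[where S = "obj A"]) (auto simp: cmp_arr[OF B])
qed (auto simp: category.src_obj[OF B] category.tgt_obj[OF B] functor_const_ob[OF A B],
    auto simp: const_functor_def)

text \<open>The exchange of variables \<open>Fun(A, Fun(B,C)) \<rightarrow> Fun(B, Fun(A,C))\<close>.\<close>

lemma slice_simps [simp]:
  "a \<in> obj A \<Longrightarrow> omap (slice A X b) a = omap (omap X a) b"
  "f \<in> arr A \<Longrightarrow> amap (slice A X b) f = component (amap X f) b"
  by (simp_all add: slice_def)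

lemma swap_ob_simps [simp]:
  "b \<in> obj B \<Longrightarrow> omap (swap_ob A B X) b = slice A X b"
  "g \<in> arr B \<Longrightarrow> nsrc (amap (swap_ob A B X) g) = slice A X (src B g)"
  "g \<in> arr B \<Longrightarrow> ntgt (amap (swap_ob A B X) g) = slice A X (tgt B g)"
  "g \<in> arr B \<Longrightarrow> component (amap (swap_ob A B X) g) \<in> extensional (obj A)"
  "g \<in> arr B \<Longrightarrow> a \<in> obj A \<Longrightarrow> component (amap (swap_ob A B X) g) a = amap (omap X a) g"
  by (simp_all add: swap_ob_def)

lemma swap_simps [simp]:
  "is_functor A (fun_cat B C) X \<Longrightarrow> omap (swap A B C) X = swap_ob A B X"
  "is_nt A (fun_cat B C) t \<Longrightarrow> nsrc (amap (swap A B C) t) = swap_ob A B (nsrc t)"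
  "is_nt A (fun_cat B C) t \<Longrightarrow> ntgt (amap (swap A B C) t) = swap_ob A B (ntgt t)"
  "is_nt A (fun_cat B C) t \<Longrightarrow> component (amap (swap A B C) t) \<in> extensional (obj B)"
  "is_nt A (fun_cat B C) t \<Longrightarrow> b \<in> obj B \<Longrightarrow>
    nsrc (component (amap (swap A B C) t) b) = slice A (nsrc t) b"
  "is_nt A (fun_cat B C) t \<Longrightarrow> b \<in> obj B \<Longrightarrow>
    ntgt (component (amap (swap A B C) t) b) = slice A (ntgt t) b"
  "is_nt A (fun_cat B C) t \<Longrightarrow> b \<in> obj B \<Longrightarrow>
    component (component (amap (swap A B C) t) b) \<in> extensional (obj A)"
  "is_nt A (fun_cat B C) t \<Longrightarrow> b \<in> obj B \<Longrightarrow> a \<in> obj A \<Longrightarrow>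
    component (component (amap (swap A B C) t) b) a = component (component t a) b"
  by (simp_all add: swap_def)

lemma functor_slice:
  assumes A: "category A" and X: "is_functor A (fun_cat B C) X" and b: "b \<in> obj B"
  shows "is_functor A C (slice A X b)"
proof (rule functorI)
  fix f g assume f: "f \<in> arr A" and g: "g \<in> arr A" and fg: "tgt A f = src A g"
  show "amap (slice A X b) (g \<cdot>\<^bsub>A\<^esub> f) = amap (slice A X b) g \<cdot>\<^bsub>C\<^esub> amap (slice A X b) f"
    using functorD(8)[OF X f g fg] by (simp add: cmp_arr[OF A f g fg] f g b)
next
  fix a assume a: "a \<in> obj A"
  show "amap (slice A X b) (ident A a) = ident C (omap (slice A X b) a)"
    using functorD(7)[OF X a] by (simp add: ident_arr[OF A] a b)
  show "omap (slice A X b) a \<in> obj C"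
    using functorD(3)[OF X a] a b by (simp add: functorD)
next
  fix f assume f: "f \<in> arr A"
  then have "is_nt B C (amap X f)" using functorD(4)[OF X f] by simp
  note ntD(4-6)[OF this b]
  moreover have "nsrc (amap X f) = omap X (src A f)" "ntgt (amap X f) = omap X (tgt A f)"
    using functorD(5,6)[OF X f] by simp_all
  ultimately show "amap (slice A X b) f \<in> arr C"
    "src C (amap (slice A X b) f) = omap (slice A X b) (src A f)"
    "tgt C (amap (slice A X b) f) = omap (slice A X b) (tgt A f)"
    using f b category.src_obj[OF A f] category.tgt_obj[OF A f] by simp_all
qed (simp_all add: slice_def)

lemma functor_swap_ob:
  assumes A: "category A" and B: "category B" and X: "is_functor A (fun_cat B C) X"
  shows "is_functor B (fun_cat A C) (swap_ob A B X)"
proof (rule functorI)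
  have Xa: "is_functor B C (omap X a)" if "a \<in> obj A" for a
    using functorD(3)[OF X that] by simp
  have Xf: "is_nt B C (amap X f)" "nsrc (amap X f) = omap X (src A f)"
    "ntgt (amap X f) = omap X (tgt A f)" if "f \<in> arr A" for f
    using functorD(4-6)[OF X that] by simp_all
  { fix g assume g: "g \<in> arr B"
    have "is_nt A C (amap (swap_ob A B X) g)"
    proof (rule ntI)
      fix f assume f: "f \<in> arr A"
      show "component (amap (swap_ob A B X) g) (tgt A f) \<cdot>\<^bsub>C\<^esub> amap (nsrc (amap (swap_ob A B X) g)) f
         = amap (ntgt (amap (swap_ob A B X) g)) f \<cdot>\<^bsub>C\<^esub> component (amap (swap_ob A B X) g) (src A f)"
        using ntD(7)[OF Xf(1)[OF f] g] g f
        by (simp add: category.src_obj[OF A] category.tgt_obj[OF A] Xf)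
    qed (use g in \<open>auto simp: functor_slice[OF A X] category.src_obj[OF B] category.tgt_obj[OF B]
        functorD[OF Xa]\<close>)
    then show "amap (swap_ob A B X) g \<in> arr (fun_cat A C)" by simp }
  { fix b assume b: "b \<in> obj B"
    show "amap (swap_ob A B X) (ident B b) = ident (fun_cat A C) (omap (swap_ob A B X) b)"
      by (rule nt_eqI[where S = "obj A"]) (use b in \<open>auto simp: ident_arr[OF B] functorD[OF Xa]\<close>) }
  { fix f g assume "f \<in> arr B" "g \<in> arr B" "tgt B f = src B g"
    then show "amap (swap_ob A B X) (g \<cdot>\<^bsub>B\<^esub> f)
        = amap (swap_ob A B X) g \<cdot>\<^bsub>fun_cat A C\<^esub> amap (swap_ob A B X) f"
      by (intro nt_eqI[where S = "obj A"]) (auto simp: cmp_arr[OF B] functorD[OF Xa]) }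
qed (auto simp: functor_slice[OF A X] category.src_obj[OF B] category.tgt_obj[OF B],
    auto simp: swap_ob_def)

lemma nt_swap_component:
  assumes A: "category A" and t: "is_nt A (fun_cat B C) t" and b: "b \<in> obj B"
  shows "is_nt A C (component (amap (swap A B C) t) b)"
proof (rule ntI)
  have ta: "is_nt B C (component t a)" "nsrc (component t a) = omap (nsrc t) a"
    "ntgt (component t a) = omap (ntgt t) a" if "a \<in> obj A" for a
    using ntD(4-6)[OF t that] by simp_all
  show "is_functor A C (nsrc (component (amap (swap A B C) t) b))"
    "is_functor A C (ntgt (component (amap (swap A B C) t) b))"
    using functor_slice[OF A ntD(1)[OF t] b] functor_slice[OF A ntD(2)[OF t] b] t b by simp_all
  fix a assume a: "a \<in> obj A"
  show "component (component (amap (swap A B C) t) b) a \<in> arr C"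
    "src C (component (component (amap (swap A B C) t) b) a)
      = omap (nsrc (component (amap (swap A B C) t) b)) a"
    "tgt C (component (component (amap (swap A B C) t) b) a)
      = omap (ntgt (component (amap (swap A B C) t) b)) a"
    using ntD(4-6)[OF ta(1)[OF a] b] ta(2,3)[OF a] t a b by simp_all
next
  fix f assume f: "f \<in> arr A"
  \<comment> \<open>Naturality of \<open>t\<close> at \<open>f\<close> is an equality in \<open>Fun(B,C)\<close>; this is its component at \<open>b\<close>.\<close>
  show "component (component (amap (swap A B C) t) b) (tgt A f) \<cdot>\<^bsub>C\<^esub>
      amap (nsrc (component (amap (swap A B C) t) b)) f
    = amap (ntgt (component (amap (swap A B C) t) b)) f \<cdot>\<^bsub>C\<^esub>
      component (component (amap (swap A B C) t) b) (src A f)"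
    using arg_cong[OF ntD(7)[OF t f], of "\<lambda>u. component u b"] t f b
    by (simp add: category.src_obj[OF A] category.tgt_obj[OF A])
qed (use t b in simp)

lemma nt_swap:
  assumes A: "category A" and B: "category B" and t: "is_nt A (fun_cat B C) t"
  shows "is_nt B (fun_cat A C) (amap (swap A B C) t)"
proof (rule ntI)
  fix g assume g: "g \<in> arr B"
  have ta: "is_nt B C (component t a)" "nsrc (component t a) = omap (nsrc t) a"
    "ntgt (component t a) = omap (ntgt t) a" if "a \<in> obj A" for a
    using ntD(4-6)[OF t that] by simp_all
  show "component (amap (swap A B C) t) (tgt B g) \<cdot>\<^bsub>fun_cat A C\<^esub> amap (nsrc (amap (swap A B C) t)) g
    = amap (ntgt (amap (swap A B C) t)) g \<cdot>\<^bsub>fun_cat A C\<^esub> component (amap (swap A B C) t) (src B g)"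
    by (rule nt_eqI[where S = "obj A"])
      (use t g ntD(7)[OF ta(1) g] ta in
        \<open>auto simp: category.src_obj[OF B] category.tgt_obj[OF B]\<close>)
qed (use t nt_swap_component[OF A t] functor_swap_ob[OF A B ntD(1)[OF t]]
    functor_swap_ob[OF A B ntD(2)[OF t]] in simp_all)

lemma functor_swap:
  assumes A: "category A" and B: "category B" and C: "category C"
  shows "is_functor (fun_cat A (fun_cat B C)) (fun_cat B (fun_cat A C)) (swap A B C)"
proof (rule functorI)
  show "omap (swap A B C) \<in> extensional (obj (fun_cat A (fun_cat B C)))"
    "amap (swap A B C) \<in> extensional (arr (fun_cat A (fun_cat B C)))"
    by (simp_all add: swap_def del: fun_cat_simps)
  note BC = category_fun_cat[OF B C]
  { fix X assume "X \<in> obj (fun_cat A (fun_cat B C))"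
    then have X: "is_functor A (fun_cat B C) X" by simp
    show "omap (swap A B C) X \<in> obj (fun_cat B (fun_cat A C))"
      using X functor_swap_ob[OF A B X] by simp
    show "amap (swap A B C) (ident (fun_cat A (fun_cat B C)) X)
        = ident (fun_cat B (fun_cat A C)) (omap (swap A B C) X)"
    proof (rule nt_eqI[where S = "obj B"])
      fix b assume b: "b \<in> obj B"
      show "component (amap (swap A B C) (ident (fun_cat A (fun_cat B C)) X)) b
          = component (ident (fun_cat B (fun_cat A C)) (omap (swap A B C) X)) b"
        by (rule nt_eqI[where S = "obj A"]) (simp_all add: X b nt_ident[OF A BC X])
    qed (simp_all add: X nt_ident[OF A BC X]) }
  { fix t assume "t \<in> arr (fun_cat A (fun_cat B C))"
    then have t: "is_nt A (fun_cat B C) t" by simp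
    show "amap (swap A B C) t \<in> arr (fun_cat B (fun_cat A C))"
      "src (fun_cat B (fun_cat A C)) (amap (swap A B C) t)
        = omap (swap A B C) (src (fun_cat A (fun_cat B C)) t)"
      "tgt (fun_cat B (fun_cat A C)) (amap (swap A B C) t)
        = omap (swap A B C) (tgt (fun_cat A (fun_cat B C)) t)"
      using t nt_swap[OF A B t] ntD(1,2)[OF t] by simp_all }
  { fix t u
    assume "t \<in> arr (fun_cat A (fun_cat B C))" "u \<in> arr (fun_cat A (fun_cat B C))"
      "tgt (fun_cat A (fun_cat B C)) t = src (fun_cat A (fun_cat B C)) u"
    then have t: "is_nt A (fun_cat B C) t" and u: "is_nt A (fun_cat B C) u" and tu: "ntgt t = nsrc u"
      by auto
    note ut = nt_cmp[OF A BC u t tu]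
    show "amap (swap A B C) (u \<cdot>\<^bsub>fun_cat A (fun_cat B C)\<^esub> t)
        = amap (swap A B C) u \<cdot>\<^bsub>fun_cat B (fun_cat A C)\<^esub> amap (swap A B C) t"
    proof (rule nt_eqI[where S = "obj B"])
      fix b assume b: "b \<in> obj B"
      show "component (amap (swap A B C) (u \<cdot>\<^bsub>fun_cat A (fun_cat B C)\<^esub> t)) b
          = component (amap (swap A B C) u \<cdot>\<^bsub>fun_cat B (fun_cat A C)\<^esub> amap (swap A B C) t) b"
        by (rule nt_eqI[where S = "obj A"]) (simp_all add: t u b ut)
    qed (simp_all add: t u ut) }
qed

text \<open>The exchange of variables is natural in the target category \<open>C\<close>, with respect to functors, and by the
  next lemma with respect to transformations.\<close>

lemma swap_post:
  assumes A: "category A" and B: "category B" and C: "category C" and C': "category C'"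
    and F: "is_functor C C' F"
  shows "functor_comp (fun_cat A (fun_cat B C)) (swap A B C') (post A (fun_cat B C) (post B C F))
    = functor_comp (fun_cat A (fun_cat B C)) (post B (fun_cat A C) (post A C F)) (swap A B C)"
proof (rule functor_fun_cat2_eqI[OF _ B])
  note BC = category_fun_cat[OF B C] and AC = category_fun_cat[OF A C]
  note ABC = category_fun_cat[OF A BC]
  show "category (fun_cat A (fun_cat B C))" by (rule ABC)
  show "is_functor (fun_cat A (fun_cat B C)) (fun_cat B (fun_cat A C'))
     (functor_comp (fun_cat A (fun_cat B C)) (swap A B C') (post A (fun_cat B C) (post B C F)))"
    by (rule functor_functor_comp[OF ABC functor_post[OF A BC functor_post[OF B C F]]
        functor_swap[OF A B C']])
  show "is_functor (fun_cat A (fun_cat B C)) (fun_cat B (fun_cat A C'))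
     (functor_comp (fun_cat A (fun_cat B C)) (post B (fun_cat A C) (post A C F)) (swap A B C))"
    by (rule functor_functor_comp[OF ABC functor_swap[OF A B C] functor_post[OF B AC
          functor_post[OF A C F]]])
  { fix X assume "X \<in> obj (fun_cat A (fun_cat B C))"
    then have X: "is_functor A (fun_cat B C) X" by simp
    note [simp] = X functor_functor_comp[OF A X functor_post[OF B C F]] functor_swap_ob[OF A B X]
      functor_slice[OF A X] functorD(3)[OF X, simplified] functorD(4)[OF X, simplified]
      functorD(4)[OF functor_swap_ob[OF A B X], simplified]
    { fix b a assume "b \<in> obj B" "a \<in> obj A"
      then show "omap (omap (omap (functor_comp (fun_cat A (fun_cat B C)) (swap A B C')
          (post A (fun_cat B C) (post B C F))) X) b) a
        = omap (omap (omap (functor_comp (fun_cat A (fun_cat B C)) (post B (fun_cat A C)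
          (post A C F)) (swap A B C)) X) b) a" by simp }
    { fix b f assume "b \<in> obj B" "f \<in> arr A"
      then show "amap (omap (omap (functor_comp (fun_cat A (fun_cat B C)) (swap A B C')
          (post A (fun_cat B C) (post B C F))) X) b) f
        = amap (omap (omap (functor_comp (fun_cat A (fun_cat B C)) (post B (fun_cat A C)
          (post A C F)) (swap A B C)) X) b) f" by simp }
    { fix g a assume "g \<in> arr B" "a \<in> obj A"
      then show "component (amap (omap (functor_comp (fun_cat A (fun_cat B C)) (swap A B C')
          (post A (fun_cat B C) (post B C F))) X) g) a
        = component (amap (omap (functor_comp (fun_cat A (fun_cat B C)) (post B (fun_cat A C)
          (post A C F)) (swap A B C)) X) g) a" by simp } }
  fix t b a assume "t \<in> arr (fun_cat A (fun_cat B C))" and ba: "b \<in> obj B" "a \<in> obj A"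
  then have t: "is_nt A (fun_cat B C) t" by simp
  show "component (component (amap (functor_comp (fun_cat A (fun_cat B C)) (swap A B C')
          (post A (fun_cat B C) (post B C F))) t) b) a
        = component (component (amap (functor_comp (fun_cat A (fun_cat B C)) (post B (fun_cat A C)
          (post A C F)) (swap A B C)) t) b) a"
    using t ba nt_whisker_left[OF A t functor_post[OF B C F]] nt_swap[OF A B t]
      nt_swap_component[OF A t] ntD(4)[OF t] by simp
qed

lemma swap_post_nt:
  assumes A: "category A" and B: "category B" and C: "category C" and C': "category C'"
    and t: "is_nt C C' t"
  shows "whisker_right (fun_cat A (fun_cat B C)) (post_nt B (fun_cat A C) (post_nt A C t)) (swap A B C)
    = whisker_left (fun_cat A (fun_cat B C)) (swap A B C') (post_nt A (fun_cat B C) (post_nt B C t))"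
proof (rule nt_eqI[where S = "obj (fun_cat A (fun_cat B C))"])
  note BC = category_fun_cat[OF B C] and AC = category_fun_cat[OF A C]
  fix X assume "X \<in> obj (fun_cat A (fun_cat B C))"
  then have X: "is_functor A (fun_cat B C) X" by simp
  note [simp] = X functor_swap_ob[OF A B X] functor_slice[OF A X] functorD(3)[OF X, simplified]
    nt_whisker_right[OF A X nt_post_nt[OF B C t]]
  note f [simp] = functor_functor_comp[OF A X functor_post[OF B C ntD(1)[OF t]]]
    functor_functor_comp[OF A X functor_post[OF B C ntD(2)[OF t]]]
  have st: "swap_ob A B (functor_comp A (post B C F) X) = functor_comp B (post A C F) (swap_ob A B X)"
    if F: "is_functor C C' F" for F
    using arg_cong[OF swap_post[OF A B C C' F], of "\<lambda>G. omap G X"]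
    by (simp add: functor_functor_comp[OF A X functor_post[OF B C F]])
  show "component (whisker_right (fun_cat A (fun_cat B C)) (post_nt B (fun_cat A C) (post_nt A C t))
      (swap A B C)) X
    = component (whisker_left (fun_cat A (fun_cat B C)) (swap A B C')
      (post_nt A (fun_cat B C) (post_nt B C t))) X"
  proof (rule nt_eqI[where S = "obj B"])
    fix b assume b: "b \<in> obj B"
    have sl: "slice A (functor_comp A (post B C F) X) b = functor_comp A F (slice A X b)"
      if F: "is_functor C C' F" for F
      using arg_cong[OF st[OF F], of "\<lambda>G. omap G b"] b by simp
    show "component (component (whisker_right (fun_cat A (fun_cat B C))
        (post_nt B (fun_cat A C) (post_nt A C t)) (swap A B C)) X) b
      = component (component (whisker_left (fun_cat A (fun_cat B C)) (swap A B C')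
        (post_nt A (fun_cat B C) (post_nt B C t))) X) b"
      by (rule nt_eqI[where S = "obj A"]) (simp_all add: b sl ntD[OF t])
  qed (simp_all add: st ntD[OF t])
qed (simp_all add: swap_post[OF A B C C'] ntD[OF t] del: fun_cat_simps)

text \<open>Exchanging the variables in the family constantly equal to \<open>X : B \<rightarrow> C\<close> gives the family that sends \<open>b\<close>
  to the functor constantly equal to \<open>X(b)\<close>.\<close>

lemma swap_const:
  assumes A: "category A" and B: "category B" and C: "category C"
  shows "functor_comp (fun_cat B C) (swap A B C) (const_functor A (fun_cat B C))
    = post B C (const_functor A C)"
proof (rule functor_fun_cat2_eqI[OF _ B])
  note BC = category_fun_cat[OF B C]
  note c = functor_const_functor[OF A BC] and c' = functor_const_functor[OF A C]
  show "category (fun_cat B C)" by (rule BC)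
  show "is_functor (fun_cat B C) (fun_cat B (fun_cat A C))
     (functor_comp (fun_cat B C) (swap A B C) (const_functor A (fun_cat B C)))"
    by (rule functor_functor_comp[OF BC c functor_swap[OF A B C]])
  show "is_functor (fun_cat B C) (fun_cat B (fun_cat A C)) (post B C (const_functor A C))"
    by (rule functor_post[OF B C c'])
qed (use functor_const_ob[OF A category_fun_cat[OF B C]]
      functorD(4)[OF functor_const_functor[OF A category_fun_cat[OF B C]]] in
      \<open>auto simp: functorD ntD\<close>)

text \<open>Constant functors are natural in the target category.\<close>

lemma post_const:
  assumes A: "category A" and B: "category B" and C: "category C" and F: "is_functor B C F"
  shows "functor_comp B (post A B F) (const_functor A B) = functor_comp B (const_functor A C) F"
proof (rule functor_fun_cat_eqI[OF B])
  show "is_functor B (fun_cat A C) (functor_comp B (post A B F) (const_functor A B))"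
    by (rule functor_functor_comp[OF B functor_const_functor[OF A B] functor_post[OF A B F]])
  show "is_functor B (fun_cat A C) (functor_comp B (const_functor A C) F)"
    by (rule functor_functor_comp[OF B F functor_const_functor[OF A C]])
qed (use functor_const_ob[OF A B] functorD(4)[OF functor_const_functor[OF A B]] in
      \<open>auto simp: functorD[OF F]\<close>)

section \<open>Functoriality of the localization\<close>

text \<open>A functor from \<open>C\<close> to \<open>C'\<close> that takes \<open>W\<close> into \<open>W'\<close>. It is given by two plain functions, constrained on
  the objects and arrows of \<open>C\<close> only: the values outside the carriers play no role for zigzags.\<close>

locale weq_functor =
  fixes C :: "('o, 'm) cat" and W :: "'m set" and C' :: "('p, 'n) cat" and W' :: "'n set"
    and \<phi>o :: "'o \<Rightarrow> 'p" and \<phi>a :: "'m \<Rightarrow> 'n"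
  assumes map_obj: "A \<in> obj C \<Longrightarrow> \<phi>o A \<in> obj C'"
    and map_arr: "f \<in> arr C \<Longrightarrow> \<phi>a f \<in> arr C'"
    and map_src: "f \<in> arr C \<Longrightarrow> src C' (\<phi>a f) = \<phi>o (src C f)"
    and map_tgt: "f \<in> arr C \<Longrightarrow> tgt C' (\<phi>a f) = \<phi>o (tgt C f)"
    and map_ident: "A \<in> obj C \<Longrightarrow> \<phi>a (ident C A) = ident C' (\<phi>o A)"
    and map_cmp: "f \<in> arr C \<Longrightarrow> g \<in> arr C \<Longrightarrow> tgt C f = src C g \<Longrightarrow>
      \<phi>a (g \<cdot>\<^bsub>C\<^esub> f) = \<phi>a g \<cdot>\<^bsub>C'\<^esub> \<phi>a f"
    and map_weq: "w \<in> arr C \<Longrightarrow> w \<in> W \<Longrightarrow> \<phi>a w \<in> W'"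
begin

lemma map_hom: "f \<in> hom C A B \<Longrightarrow> \<phi>a f \<in> hom C' (\<phi>o A) (\<phi>o B)"
  by (auto simp: hom_def map_arr map_src map_tgt)

lemma map_zigzag:
  "zigzag C W A p B \<Longrightarrow> zigzag C' W' (\<phi>o A) (map (map_step \<phi>a) p) (\<phi>o B)"
proof (induction p arbitrary: A)
  case (Cons x p)
  then show ?case
    by (cases x) (auto simp: map_arr map_src map_tgt map_weq dest: Cons.IH)
qed (simp add: map_obj)

lemma zigzag_arrs: "zigzag C W A p B \<Longrightarrow> x \<in> set p \<Longrightarrow> step_arrs x \<subseteq> arr C"
proof (induction p arbitrary: A)
  case (Cons y p)
  then show ?case by (cases y) auto
qed simp

lemma map_we_zigzag:
  assumes "we_zigzag C W A p B"
  shows "we_zigzag C' W' (\<phi>o A) (map (map_step \<phi>a) p) (\<phi>o B)"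
proof -
  have "step_arrs (map_step \<phi>a x) \<subseteq> W'" if "x \<in> set p" for x
    using assms that zigzag_arrs[of A p B x] map_weq by (auto simp: we_zigzag_def step.set_map)
  then show ?thesis using assms map_zigzag by (simp add: we_zigzag_def)
qed

lemma map_loc_eq:
  "loc_eq C W A B p q \<Longrightarrow>
    loc_eq C' W' (\<phi>o A) (\<phi>o B) (map (map_step \<phi>a) p) (map (map_step \<phi>a) q)"
proof (induction rule: loc_eq.induct)
  case (refl A p B)
  then show ?case by (intro loc_eq.refl map_zigzag)
next
  case (trans A B p q r)
  then show ?case by (blast intro: loc_eq.trans)
next
  case (append A B p p' B' q q')
  then show ?case by (auto intro: loc_eq.append)
next
  case (ident A)
  then show ?case by (simp add: map_ident map_obj loc_eq.ident)
next
  case (cmp f A B g B')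
  then show ?case
    using loc_eq.cmp[OF map_hom[OF cmp(1)] map_hom[OF cmp(2)]] by (simp add: map_cmp hom_def)
next
  case (inv_right w A B)
  then show ?case
    using loc_eq.inv_right[OF map_hom[OF inv_right(1)], of W'] map_weq by (simp add: hom_def)
next
  case (inv_left w A B)
  then show ?case
    using loc_eq.inv_left[OF map_hom[OF inv_left(1)], of W'] map_weq by (simp add: hom_def)
qed (rule loc_eq.sym)

end

lemma zigzag_map_cong:
  assumes "zigzag C W A p B" and "\<And>t. t \<in> arr C \<Longrightarrow> f t = g t"
  shows "map (map_step f) p = map (map_step g) p"
  using assms(1)
proof (induction p arbitrary: A)
  case (Cons x p)
  then show ?case by (cases x) (auto simp: assms(2))
qed simp

lemma loc_arr_eqI: "loc_eq C W A B p q \<Longrightarrow> loc_arr C W A p B = loc_arr C W A q B"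
  by (auto simp: loc_arr_def intro: loc_eq.sym loc_eq.trans)

lemma loc_arr_eqD:
  assumes "loc_arr C W A p B = loc_arr C W A q B" "zigzag C W A q B"
  shows "loc_eq C W A B p q"
  using assms loc_eq.refl[OF assms(2)] by (auto simp: loc_arr_def)

lemma loc_arr_eq_ident_iff:
  assumes "A \<in> obj C"
  shows "loc_arr C W A p A = ident (localization C W) A \<longleftrightarrow> loc_eq C W A A p []"
  using assms loc_arr_eqI[of C W A A p "[]"] loc_arr_eqD[of C W A p A "[]"]
  by (auto simp: localization_def)

lemma loc_arr_cmp:
  assumes p: "zigzag C W A p B" and q: "zigzag C W B q B'"
  shows "loc_arr C W B q B' \<cdot>\<^bsub>localization C W\<^esub> loc_arr C W A p B = loc_arr C W A (p @ q) B'"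
proof -
  have "(\<exists>p' q'. loc_eq C W A B p p' \<and> loc_eq C W B B' q q' \<and> loc_eq C W A B' (p' @ q') r)
      \<longleftrightarrow> loc_eq C W A B' (p @ q) r" for r
    using loc_eq.refl[OF p] loc_eq.refl[OF q] by (blast intro: loc_eq.append loc_eq.trans)
  then show ?thesis by (simp add: localization_def loc_arr_def Bex_def)
qed

text \<open>Invertibility in the localization, expressed by zigzags: the inverse of the class of \<open>f\<close> is the class
  of some zigzag \<open>q\<close>.\<close>

lemma is_iso_localization_iff:
  assumes f: "f \<in> hom C A B" and A: "A \<in> obj C" and B: "B \<in> obj C"
  shows "is_iso (localization C W) (loc_arr C W A [Fwd f] B) \<longleftrightarrow>
    (\<exists>q. zigzag C W B q A \<and> loc_eq C W A A ([Fwd f] @ q) [] \<and> loc_eq C W B B (q @ [Fwd f]) [])"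
proof -
  have zf: "zigzag C W A [Fwd f] B" using f B by (auto simp: hom_def)
  have arr: "loc_arr C W A [Fwd f] B \<in> arr (localization C W)"
    using zf unfolding localization_def by (simp del: zigzag.simps) blast
  have st: "src (localization C W) (loc_arr C W A' q B') = A'"
    "tgt (localization C W) (loc_arr C W A' q B') = B'" for A' B' q
    by (simp_all add: localization_def loc_arr_def)
  have hom: "hom (localization C W) B A = {loc_arr C W B q A | q. zigzag C W B q A}"
    by (auto simp: hom_def st) (auto simp: localization_def st[unfolded localization_def, simplified]
      loc_arr_def)
  have "is_iso (localization C W) (loc_arr C W A [Fwd f] B) \<longleftrightarrow> (\<exists>q. zigzag C W B q A \<and>
      loc_arr C W B q A \<cdot>\<^bsub>localization C W\<^esub> loc_arr C W A [Fwd f] B = ident (localization C W) A \<and>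
      loc_arr C W A [Fwd f] B \<cdot>\<^bsub>localization C W\<^esub> loc_arr C W B q A = ident (localization C W) B)"
    using arr unfolding is_iso_def st hom by blast
  then show ?thesis
    using loc_arr_cmp[OF zf] loc_arr_cmp[OF _ zf] loc_arr_eq_ident_iff[OF A] loc_arr_eq_ident_iff[OF B]
    by (metis (no_types, lifting))
qed

lemma is_iso_localization_weq:
  assumes "category C" "f \<in> arr C" "f \<in> W"
  shows "is_iso (localization C W) (loc_arr C W (src C f) [Fwd f] (tgt C f))"
proof -
  have f: "f \<in> hom C (src C f) (tgt C f)" using assms by (simp add: hom_def)
  have "zigzag C W (tgt C f) [Bwd f] (src C f)"
    using assms category.src_obj by auto
  with loc_eq.inv_right[OF f assms(3)] loc_eq.inv_left[OF f assms(3)] show ?thesis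
    unfolding is_iso_localization_iff[OF f category.src_obj[OF assms(1,2)]
      category.tgt_obj[OF assms(1,2)]]
    by (intro exI[of _ "[Bwd f]"]) simp
qed

lemma (in weq_functor) map_is_iso_localization:
  assumes C: "category C" and C': "category C'" and f: "f \<in> arr C"
    and iso: "is_iso (localization C W) (loc_arr C W (src C f) [Fwd f] (tgt C f))"
  shows "is_iso (localization C' W')
    (loc_arr C' W' (src C' (\<phi>a f)) [Fwd (\<phi>a f)] (tgt C' (\<phi>a f)))"
proof -
  note o = category.src_obj[OF C f] category.tgt_obj[OF C f]
  have h: "f \<in> hom C (src C f) (tgt C f)" using f by (simp add: hom_def)
  from iso obtain q where q: "zigzag C W (tgt C f) q (src C f)"
      "loc_eq C W (src C f) (src C f) ([Fwd f] @ q) []"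
      "loc_eq C W (tgt C f) (tgt C f) (q @ [Fwd f]) []"
    unfolding is_iso_localization_iff[OF h o] by blast
  show ?thesis
    unfolding map_src[OF f] map_tgt[OF f]
      is_iso_localization_iff[OF map_hom[OF h] map_obj[OF o(1)] map_obj[OF o(2)]]
    using map_zigzag[OF q(1)] map_loc_eq[OF q(2)] map_loc_eq[OF q(3)]
    by (intro exI[of _ "map (map_step \<phi>a) q"]) simp
qed

lemma saturatedD:
  assumes "saturated C W" "f \<in> arr C"
    and "is_iso (localization C W) (loc_arr C W (src C f) [Fwd f] (tgt C f))"
  shows "f \<in> W"
  using assms unfolding saturated_def by blast

text \<open>Evaluation at an object preserves weak equivalences.\<close>

lemma weq_functor_eval:
  assumes a: "a \<in> obj A"
  shows "weq_functor (fun_cat A B) (objectwise A B E) B E (\<lambda>F. omap F a) (\<lambda>t. component t a)"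
  by unfold_locales (use a in \<open>auto simp: functorD ntD objectwise_def\<close>)

text \<open>A transformation inverted by the localization has all its components inverted, as evaluation
  at an object descends to localizations.\<close>

lemma saturated_objectwise:
  assumes A: "category A" and B: "category B" and sat: "saturated B E"
  shows "saturated (fun_cat A B) (objectwise A B E)"
proof -
  note AB = category_fun_cat[OF A B]
  have "t \<in> objectwise A B E"
    if t: "t \<in> arr (fun_cat A B)" and iso: "is_iso (localization (fun_cat A B) (objectwise A B E))
      (loc_arr (fun_cat A B) (objectwise A B E) (src (fun_cat A B) t) [Fwd t] (tgt (fun_cat A B) t))"
    for t
  proof -
    have "component t a \<in> E" if a: "a \<in> obj A" for a
      by (rule saturatedD[OF sat])
        (use weq_functor.map_is_iso_localization[OF weq_functor_eval[OF a] AB B t iso] t a in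
          \<open>auto simp: ntD\<close>)
    then show ?thesis using t by (simp add: objectwise_def)
  qed
  moreover have "t \<in> arr (fun_cat A B)" if "t \<in> objectwise A B E" for t
    using that by (simp add: objectwise_def)
  ultimately show ?thesis
    unfolding saturated_def using is_iso_localization_weq[OF AB, of _ "objectwise A B E"]
    by (intro set_eqI iffI) auto
qed

section \<open>Coproducts in functor categories\<close>

lemma coproductD:
  assumes "is_coproduct C J X P \<iota>"
  shows "P \<in> obj C" "j \<in> J \<Longrightarrow> X j \<in> obj C" "j \<in> J \<Longrightarrow> \<iota> j \<in> hom C (X j) P"
  using assms by (auto simp: is_coproduct_def)

lemma coproduct_ex1:
  assumes "is_coproduct C J X P \<iota>" "Y \<in> obj C" "\<And>j. j \<in> J \<Longrightarrow> f j \<in> hom C (X j) Y"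
  shows "\<exists>!h. h \<in> hom C P Y \<and> (\<forall>j \<in> J. h \<cdot>\<^bsub>C\<^esub> \<iota> j = f j)"
  using assms by (auto simp: is_coproduct_def)

lemma coproduct_factor:
  assumes "is_coproduct C J X P \<iota>" "Y \<in> obj C" "\<And>j. j \<in> J \<Longrightarrow> f j \<in> hom C (X j) Y"
  obtains h where "h \<in> hom C P Y" "\<And>j. j \<in> J \<Longrightarrow> h \<cdot>\<^bsub>C\<^esub> \<iota> j = f j"
  using coproduct_ex1[OF assms] by blast

lemma coproduct_arr_eqI:
  assumes C: "category C" and P: "is_coproduct C J X P \<iota>"
    and u: "u \<in> hom C P Y" and v: "v \<in> hom C P Y"
    and eq: "\<And>j. j \<in> J \<Longrightarrow> u \<cdot>\<^bsub>C\<^esub> \<iota> j = v \<cdot>\<^bsub>C\<^esub> \<iota> j"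
  shows "u = v"
proof -
  have Y: "Y \<in> obj C" using u category.tgt_obj[OF C] by (auto simp: hom_def)
  have "\<exists>!h. h \<in> hom C P Y \<and> (\<forall>j \<in> J. h \<cdot>\<^bsub>C\<^esub> \<iota> j = v \<cdot>\<^bsub>C\<^esub> \<iota> j)"
    by (rule coproduct_ex1[OF P Y]) (use category.cmp_hom[OF C coproductD(3)[OF P] v] in auto)
  then show ?thesis using u v eq by blast
qed

lemma is_coproduct_cong:
  assumes "\<And>j. j \<in> J \<Longrightarrow> X j = X' j" "\<And>j. j \<in> J \<Longrightarrow> \<iota> j = \<iota>' j"
  shows "is_coproduct C J X P \<iota> \<longleftrightarrow> is_coproduct C J X' P \<iota>'"
  using assms by (simp add: is_coproduct_def)

lemma coproduct_reindex:
  assumes \<sigma>: "bij_betw \<sigma> K J" and P: "is_coproduct C K (\<lambda>k. X (\<sigma> k)) P \<iota>"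
  shows "is_coproduct C J X P (\<lambda>j. \<iota> (inv_into K \<sigma> j))"
proof -
  have J: "J = \<sigma> ` K" and inj: "inj_on \<sigma> K" using \<sigma> by (auto simp: bij_betw_def)
  show ?thesis
    unfolding is_coproduct_def J
  proof (intro conjI ballI allI impI)
    fix Y f assume Y: "Y \<in> obj C" and f: "\<forall>j \<in> \<sigma> ` K. f j \<in> hom C (X j) Y"
    have "\<exists>!h. h \<in> hom C P Y \<and> (\<forall>k \<in> K. h \<cdot>\<^bsub>C\<^esub> \<iota> k = f (\<sigma> k))"
      by (rule coproduct_ex1[OF P Y]) (use f in auto)
    then show "\<exists>!h. h \<in> hom C P Y \<and> (\<forall>j \<in> \<sigma> ` K. h \<cdot>\<^bsub>C\<^esub> \<iota> (inv_into K \<sigma> j) = f j)"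
      using inj by simp
  qed (use coproductD[OF P] inj in auto)
qed

lemma ex_finite_coproduct:
  assumes C: "has_finite_coproducts C" and J: "finite J" and X: "\<And>j. j \<in> J \<Longrightarrow> X j \<in> obj C"
  shows "\<exists>P \<iota>. is_coproduct C J X P \<iota>"
proof -
  obtain \<sigma> :: "nat \<Rightarrow> _" where \<sigma>: "bij_betw \<sigma> {0..<card J} J"
    using ex_bij_betw_nat_finite[OF J] by blast
  have "(\<lambda>k. X (\<sigma> k)) \<in> {0..<card J} \<rightarrow> obj C"
    using X bij_betwE[OF \<sigma>] by auto
  then obtain P \<iota> where "is_coproduct C {0..<card J} (\<lambda>k. X (\<sigma> k)) P \<iota>"
    using C unfolding has_finite_coproducts_def by blast
  from coproduct_reindex[OF \<sigma> this] show ?thesis by blast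
qed

text \<open>Coproducts are stable under isomorphism.\<close>

lemma coproduct_transfer:
  assumes C: "category C" and P: "is_coproduct C J X P \<iota>"
    and h: "h \<in> hom C P P'" and k: "k \<in> hom C P' P"
    and kh: "k \<cdot>\<^bsub>C\<^esub> h = ident C P" and hk: "h \<cdot>\<^bsub>C\<^esub> k = ident C P'"
    and \<iota>': "\<And>j. j \<in> J \<Longrightarrow> \<iota>' j = h \<cdot>\<^bsub>C\<^esub> \<iota> j"
  shows "is_coproduct C J X P' \<iota>'"
  unfolding is_coproduct_def
proof (intro conjI ballI allI impI)
  interpret category C by (rule C)
  show "P' \<in> obj C" using h tgt_obj by (auto simp: hom_def)
  { fix j assume j: "j \<in> J"
    show "X j \<in> obj C" by (rule coproductD(2)[OF P j])
    show "\<iota>' j \<in> hom C (X j) P'"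
      unfolding \<iota>'[OF j] by (rule cmp_hom[OF coproductD(3)[OF P j] h]) }
  fix Y f assume Y: "Y \<in> obj C" and f: "\<forall>j \<in> J. f j \<in> hom C (X j) Y"
  obtain u where u: "u \<in> hom C P Y" and uf: "\<And>j. j \<in> J \<Longrightarrow> u \<cdot>\<^bsub>C\<^esub> \<iota> j = f j"
    by (rule coproduct_factor[OF P Y, of f]) (use f in auto)
  show "\<exists>!h. h \<in> hom C P' Y \<and> (\<forall>j \<in> J. h \<cdot>\<^bsub>C\<^esub> \<iota>' j = f j)"
  proof (intro ex1I conjI ballI)
    show "u \<cdot>\<^bsub>C\<^esub> k \<in> hom C P' Y" by (rule cmp_hom[OF k u])
    fix j assume j: "j \<in> J"
    have "(u \<cdot>\<^bsub>C\<^esub> k) \<cdot>\<^bsub>C\<^esub> (h \<cdot>\<^bsub>C\<^esub> \<iota> j) = u \<cdot>\<^bsub>C\<^esub> ((k \<cdot>\<^bsub>C\<^esub> h) \<cdot>\<^bsub>C\<^esub> \<iota> j)"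
      using cmp_assoc[OF cmp_hom[OF coproductD(3)[OF P j] h] k u]
        cmp_assoc[OF coproductD(3)[OF P j] h k] by simp
    then show "(u \<cdot>\<^bsub>C\<^esub> k) \<cdot>\<^bsub>C\<^esub> \<iota>' j = f j"
      using j cmp_ident_left[OF coproductD(3)[OF P j]] by (simp add: kh uf \<iota>')
  next
    fix v assume v: "v \<in> hom C P' Y \<and> (\<forall>j \<in> J. v \<cdot>\<^bsub>C\<^esub> \<iota>' j = f j)"
    then have vY: "v \<in> hom C P' Y" by simp
    have "v \<cdot>\<^bsub>C\<^esub> h = u"
    proof (rule coproduct_arr_eqI[OF C P cmp_hom[OF h vY] u])
      fix j assume j: "j \<in> J"
      show "(v \<cdot>\<^bsub>C\<^esub> h) \<cdot>\<^bsub>C\<^esub> \<iota> j = u \<cdot>\<^bsub>C\<^esub> \<iota> j"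
        using cmp_assoc[OF coproductD(3)[OF P j] h vY] v j by (simp add: uf \<iota>')
    qed
    then show "v = u \<cdot>\<^bsub>C\<^esub> k"
      using cmp_assoc[OF k h vY] cmp_ident_right[OF vY] by (simp add: hk)
  qed
qed

lemma coproduct_unique:
  assumes C: "category C" and P: "is_coproduct C J X P \<iota>" and P': "is_coproduct C J X P' \<iota>'"
  obtains h k where "h \<in> hom C P P'" "k \<in> hom C P' P"
    "k \<cdot>\<^bsub>C\<^esub> h = ident C P" "h \<cdot>\<^bsub>C\<^esub> k = ident C P'" "\<And>j. j \<in> J \<Longrightarrow> \<iota>' j = h \<cdot>\<^bsub>C\<^esub> \<iota> j"
proof -
  interpret category C by (rule C)
  have *: "v \<cdot>\<^bsub>C\<^esub> u = ident C Q"
    if Q: "is_coproduct C J X Q q" and Q': "is_coproduct C J X Q' q'" and u: "u \<in> hom C Q Q'"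
      and v: "v \<in> hom C Q' Q" and uq: "\<And>j. j \<in> J \<Longrightarrow> u \<cdot>\<^bsub>C\<^esub> q j = q' j"
      and vq: "\<And>j. j \<in> J \<Longrightarrow> v \<cdot>\<^bsub>C\<^esub> q' j = q j" for Q q Q' q' u v
  proof (rule coproduct_arr_eqI[OF C Q cmp_hom[OF u v] ident_hom[OF coproductD(1)[OF Q]]])
    fix j assume j: "j \<in> J"
    show "(v \<cdot>\<^bsub>C\<^esub> u) \<cdot>\<^bsub>C\<^esub> q j = ident C Q \<cdot>\<^bsub>C\<^esub> q j"
      using cmp_assoc[OF coproductD(3)[OF Q j] u v] cmp_ident_left[OF coproductD(3)[OF Q j]] j
      by (simp add: uq vq)
  qed
  obtain h where h: "h \<in> hom C P P'" "\<And>j. j \<in> J \<Longrightarrow> h \<cdot>\<^bsub>C\<^esub> \<iota> j = \<iota>' j"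
    using coproduct_factor[OF P coproductD(1)[OF P'] coproductD(3)[OF P']] by blast
  obtain k where k: "k \<in> hom C P' P" "\<And>j. j \<in> J \<Longrightarrow> k \<cdot>\<^bsub>C\<^esub> \<iota>' j = \<iota> j"
    using coproduct_factor[OF P' coproductD(1)[OF P] coproductD(3)[OF P]] by blast
  show ?thesis
    by (rule that[OF h(1) k(1) *[OF P P' h(1) k(1) h(2) k(2)] *[OF P' P k(1) h(1) k(2) h(2)]])
      (use h(2) in auto)
qed

text \<open>An objectwise coproduct is a coproduct.\<close>

lemma coproduct_fun_catI:
  assumes A: "category A" and B: "category B"
    and X: "\<And>j. j \<in> J \<Longrightarrow> is_functor A B (X j)" and P: "is_functor A B P"
    and \<iota>: "\<And>j. j \<in> J \<Longrightarrow> \<iota> j \<in> hom (fun_cat A B) (X j) P"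
    and cop: "\<And>a. a \<in> obj A \<Longrightarrow>
      is_coproduct B J (\<lambda>j. omap (X j) a) (omap P a) (\<lambda>j. component (\<iota> j) a)"
  shows "is_coproduct (fun_cat A B) J X P \<iota>"
  unfolding is_coproduct_def
proof (intro conjI ballI allI impI)
  interpret B: category B by (rule B)
  have \<iota>': "is_nt A B (\<iota> j)" "nsrc (\<iota> j) = X j" "ntgt (\<iota> j) = P" if "j \<in> J" for j
    using \<iota>[OF that] by (auto simp: hom_def)
  fix Y f assume "Y \<in> obj (fun_cat A B)" and f: "\<forall>j \<in> J. f j \<in> hom (fun_cat A B) (X j) Y"
  then have Y: "is_functor A B Y" by simp
  have f': "is_nt A B (f j)" "nsrc (f j) = X j" "ntgt (f j) = Y" if "j \<in> J" for j
    using f that by (auto simp: hom_def)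
  have fa: "component (f j) a \<in> hom B (omap (X j) a) (omap Y a)" if "j \<in> J" "a \<in> obj A" for j a
    using ntD(4-6)[OF f'(1)[OF that(1)] that(2)] f'(2,3)[OF that(1)] by (simp add: hom_def)
  \<comment> \<open>The factorization at each object; it is natural by the uniqueness in the universal property.\<close>
  define H where "H a = (THE h. h \<in> hom B (omap P a) (omap Y a) \<and>
    (\<forall>j \<in> J. h \<cdot>\<^bsub>B\<^esub> component (\<iota> j) a = component (f j) a))" for a
  have H: "H a \<in> hom B (omap P a) (omap Y a)"
    "\<And>j. j \<in> J \<Longrightarrow> H a \<cdot>\<^bsub>B\<^esub> component (\<iota> j) a = component (f j) a" if a: "a \<in> obj A" for a
    using theI'[OF coproduct_ex1[OF cop[OF a] functorD(3)[OF Y a], of "\<lambda>j. component (f j) a"]] fa a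
    unfolding H_def by auto
  define t where "t = \<lparr>nsrc = P, ntgt = Y, component = (\<lambda>a \<in> obj A. H a)\<rparr>"
  have t: "is_nt A B t"
  proof (rule ntI)
    fix m assume m: "m \<in> arr A"
    let ?a = "src A m" and ?b = "tgt A m"
    have a: "?a \<in> obj A" and b: "?b \<in> obj A"
      using category.src_obj[OF A m] category.tgt_obj[OF A m] by auto
    have Pm: "amap P m \<in> hom B (omap P ?a) (omap P ?b)" using functorD(4-6)[OF P m] by (simp add: hom_def)
    have Ym: "amap Y m \<in> hom B (omap Y ?a) (omap Y ?b)" using functorD(4-6)[OF Y m] by (simp add: hom_def)
    have "H ?b \<cdot>\<^bsub>B\<^esub> amap P m = amap Y m \<cdot>\<^bsub>B\<^esub> H ?a"
    proof (rule coproduct_arr_eqI[OF B cop[OF a] B.cmp_hom[OF Pm H(1)[OF b]] B.cmp_hom[OF H(1)[OF a] Ym]])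
      fix j assume j: "j \<in> J"
      have Xm: "amap (X j) m \<in> hom B (omap (X j) ?a) (omap (X j) ?b)"
        using functorD(4-6)[OF X[OF j] m] by (simp add: hom_def)
      have "(H ?b \<cdot>\<^bsub>B\<^esub> amap P m) \<cdot>\<^bsub>B\<^esub> component (\<iota> j) ?a
          = H ?b \<cdot>\<^bsub>B\<^esub> (component (\<iota> j) ?b \<cdot>\<^bsub>B\<^esub> amap (X j) m)"
        using ntD(7)[OF \<iota>'(1)[OF j] m] B.cmp_assoc[OF coproductD(3)[OF cop[OF a] j] Pm H(1)[OF b]] \<iota>'[OF j]
        by simp
      also have "\<dots> = component (f j) ?b \<cdot>\<^bsub>B\<^esub> amap (X j) m"
        using B.cmp_assoc[OF Xm coproductD(3)[OF cop[OF b] j] H(1)[OF b]] H(2)[OF b j] by simp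
      also have "\<dots> = amap Y m \<cdot>\<^bsub>B\<^esub> component (f j) ?a"
        using ntD(7)[OF f'(1)[OF j] m] f'[OF j] by simp
      also have "\<dots> = (amap Y m \<cdot>\<^bsub>B\<^esub> H ?a) \<cdot>\<^bsub>B\<^esub> component (\<iota> j) ?a"
        using B.cmp_assoc[OF coproductD(3)[OF cop[OF a] j] H(1)[OF a] Ym] H(2)[OF a j] by simp
      finally show "(H ?b \<cdot>\<^bsub>B\<^esub> amap P m) \<cdot>\<^bsub>B\<^esub> component (\<iota> j) ?a
        = (amap Y m \<cdot>\<^bsub>B\<^esub> H ?a) \<cdot>\<^bsub>B\<^esub> component (\<iota> j) ?a" .
    qed
    then show "component t (tgt A m) \<cdot>\<^bsub>B\<^esub> amap (nsrc t) m = amap (ntgt t) m \<cdot>\<^bsub>B\<^esub> component t (src A m)"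
      using a b by (simp add: t_def)
  qed (use H(1) P Y in \<open>auto simp: t_def hom_def\<close>)
  show "\<exists>!h. h \<in> hom (fun_cat A B) P Y \<and> (\<forall>j \<in> J. h \<cdot>\<^bsub>fun_cat A B\<^esub> \<iota> j = f j)"
  proof (rule ex1I[of _ t], intro conjI ballI)
    show "t \<in> hom (fun_cat A B) P Y" using t by (simp add: hom_def) (simp add: t_def)
    fix j assume j: "j \<in> J"
    show "t \<cdot>\<^bsub>fun_cat A B\<^esub> \<iota> j = f j"
      by (rule nt_eqI[where S = "obj A"])
        (use f'[OF j] \<iota>'[OF j] ntD(3)[OF f'(1)[OF j]] H(2) j in \<open>auto simp: t_def\<close>)
  next
    fix u assume u: "u \<in> hom (fun_cat A B) P Y \<and> (\<forall>j \<in> J. u \<cdot>\<^bsub>fun_cat A B\<^esub> \<iota> j = f j)"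
    then have u': "is_nt A B u" "nsrc u = P" "ntgt u = Y" by (auto simp: hom_def)
    show "u = t"
    proof (rule nt_eqI[where S = "obj A"])
      fix a assume a: "a \<in> obj A"
      have ua: "component u a \<in> hom B (omap P a) (omap Y a)"
        using ntD(4-6)[OF u'(1) a] u' by (simp add: hom_def)
      have "component u a = H a"
      proof (rule coproduct_arr_eqI[OF B cop[OF a] ua H(1)[OF a]])
        fix j assume j: "j \<in> J"
        then have "component (u \<cdot>\<^bsub>fun_cat A B\<^esub> \<iota> j) a = component (f j) a" using u by simp
        then show "component u a \<cdot>\<^bsub>B\<^esub> component (\<iota> j) a = H a \<cdot>\<^bsub>B\<^esub> component (\<iota> j) a"
          using H(2)[OF a j] a by simp
      qed
      then show "component u a = component t a" using a by (simp add: t_def)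
    qed (use u' ntD(3)[OF u'(1)] in \<open>auto simp: t_def\<close>)
  qed
qed (use X P \<iota> in auto)

text \<open>If coproducts exist at every object, a choice of them extends uniquely to a functor \<open>P\<close> such that the
  inclusions are natural, and this functor is the coproduct.\<close>

lemma ex_objectwise_coproduct:
  assumes A: "category A" and B: "category B"
    and X: "\<And>j. j \<in> J \<Longrightarrow> is_functor A B (X j)"
    and ex: "\<And>a. a \<in> obj A \<Longrightarrow> \<exists>P \<iota>. is_coproduct B J (\<lambda>j. omap (X j) a) P \<iota>"
  obtains P \<iota> where "is_coproduct (fun_cat A B) J X P \<iota>"
    "\<And>a. a \<in> obj A \<Longrightarrow>
      is_coproduct B J (\<lambda>j. omap (X j) a) (omap P a) (\<lambda>j. component (\<iota> j) a)"
proof -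
  interpret B: category B by (rule B)
  obtain Po \<iota>o where cop: "\<And>a. a \<in> obj A \<Longrightarrow> is_coproduct B J (\<lambda>j. omap (X j) a) (Po a) (\<iota>o a)"
    using ex by metis
  have Xm: "amap (X j) m \<in> hom B (omap (X j) (src A m)) (omap (X j) (tgt A m))"
    if "j \<in> J" "m \<in> arr A" for j m
    using functorD(4-6)[OF X[OF that(1)] that(2)] by (simp add: hom_def)
  \<comment> \<open>The action of \<open>P\<close> on an arrow \<open>m\<close> is the coproduct of the actions of the \<open>X j\<close>.\<close>
  define H where "H m = (THE h. h \<in> hom B (Po (src A m)) (Po (tgt A m)) \<and>
    (\<forall>j \<in> J. h \<cdot>\<^bsub>B\<^esub> \<iota>o (src A m) j = \<iota>o (tgt A m) j \<cdot>\<^bsub>B\<^esub> amap (X j) m))" for m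
  have H: "H m \<in> hom B (Po (src A m)) (Po (tgt A m))"
    "\<And>j. j \<in> J \<Longrightarrow> H m \<cdot>\<^bsub>B\<^esub> \<iota>o (src A m) j = \<iota>o (tgt A m) j \<cdot>\<^bsub>B\<^esub> amap (X j) m"
    if m: "m \<in> arr A" for m
  proof -
    note b = cop[OF category.tgt_obj[OF A m]]
    have "\<exists>!h. h \<in> hom B (Po (src A m)) (Po (tgt A m)) \<and>
        (\<forall>j \<in> J. h \<cdot>\<^bsub>B\<^esub> \<iota>o (src A m) j = \<iota>o (tgt A m) j \<cdot>\<^bsub>B\<^esub> amap (X j) m)"
      by (rule coproduct_ex1[OF cop[OF category.src_obj[OF A m]] coproductD(1)[OF b]])
        (rule B.cmp_hom[OF Xm coproductD(3)[OF b]]; use m in simp)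
    from theI'[OF this] show "H m \<in> hom B (Po (src A m)) (Po (tgt A m))"
      "\<And>j. j \<in> J \<Longrightarrow> H m \<cdot>\<^bsub>B\<^esub> \<iota>o (src A m) j = \<iota>o (tgt A m) j \<cdot>\<^bsub>B\<^esub> amap (X j) m"
      unfolding H_def by auto
  qed
  define P where "P = \<lparr>omap = (\<lambda>a \<in> obj A. Po a), amap = (\<lambda>m \<in> arr A. H m)\<rparr>"
  have P: "is_functor A B P"
  proof (rule functorI)
    fix a assume a: "a \<in> obj A"
    note i = ident_arr[OF A a]
    show "omap P a \<in> obj B" using coproductD(1)[OF cop[OF a]] a by (simp add: P_def)
    have "H (ident A a) = ident B (Po a)"
    proof (rule coproduct_arr_eqI[OF B cop[OF a] _ B.ident_hom[OF coproductD(1)[OF cop[OF a]]]])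
      show "H (ident A a) \<in> hom B (Po a) (Po a)" using H(1)[OF i(1)] i by simp
      fix j assume j: "j \<in> J"
      note c = coproductD(3)[OF cop[OF a] j]
      show "H (ident A a) \<cdot>\<^bsub>B\<^esub> \<iota>o a j = ident B (Po a) \<cdot>\<^bsub>B\<^esub> \<iota>o a j"
        using H(2)[OF i(1) j] B.cmp_ident_left[OF c] B.cmp_ident_right[OF c] i
          functorD(7)[OF X[OF j] a] by simp
    qed
    then show "amap P (ident A a) = ident B (omap P a)" using a i by (simp add: P_def)
  next
    fix m assume m: "m \<in> arr A"
    then show "amap P m \<in> arr B" "src B (amap P m) = omap P (src A m)"
      "tgt B (amap P m) = omap P (tgt A m)"
      using H(1)[OF m] category.src_obj[OF A m] category.tgt_obj[OF A m]
      by (auto simp: P_def hom_def)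
  next
    fix m n assume m: "m \<in> arr A" and n: "n \<in> arr A" and mn: "tgt A m = src A n"
    note nm = cmp_arr[OF A m n mn]
    let ?a = "src A m" and ?b = "src A n" and ?c = "tgt A n"
    have a: "?a \<in> obj A" and b: "?b \<in> obj A" and c: "?c \<in> obj A"
      using m n category.src_obj[OF A] category.tgt_obj[OF A] by auto
    have Hm: "H m \<in> hom B (Po ?a) (Po ?b)" and Hn: "H n \<in> hom B (Po ?b) (Po ?c)"
      using H(1)[OF m] H(1)[OF n] mn by auto
    have "H (n \<cdot>\<^bsub>A\<^esub> m) = H n \<cdot>\<^bsub>B\<^esub> H m"
    proof (rule coproduct_arr_eqI[OF B cop[OF a] _ B.cmp_hom[OF Hm Hn]])
      show "H (n \<cdot>\<^bsub>A\<^esub> m) \<in> hom B (Po ?a) (Po ?c)" using H(1)[OF nm(1)] nm by simp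
      fix j assume j: "j \<in> J"
      have Xm': "amap (X j) m \<in> hom B (omap (X j) ?a) (omap (X j) ?b)" using Xm[OF j m] mn by simp
      note Xn' = Xm[OF j n]
      note \<iota>a = coproductD(3)[OF cop[OF a] j] and \<iota>b = coproductD(3)[OF cop[OF b] j]
        and \<iota>c = coproductD(3)[OF cop[OF c] j]
      have "H (n \<cdot>\<^bsub>A\<^esub> m) \<cdot>\<^bsub>B\<^esub> \<iota>o ?a j = \<iota>o ?c j \<cdot>\<^bsub>B\<^esub> (amap (X j) n \<cdot>\<^bsub>B\<^esub> amap (X j) m)"
        using H(2)[OF nm(1) j] nm functorD(8)[OF X[OF j] m n mn] by simp
      also have "\<dots> = (H n \<cdot>\<^bsub>B\<^esub> \<iota>o ?b j) \<cdot>\<^bsub>B\<^esub> amap (X j) m"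
        using B.cmp_assoc[OF Xm' Xn' \<iota>c] H(2)[OF n j] by simp
      also have "\<dots> = H n \<cdot>\<^bsub>B\<^esub> (H m \<cdot>\<^bsub>B\<^esub> \<iota>o ?a j)"
        using B.cmp_assoc[OF Xm' \<iota>b Hn] H(2)[OF m j] mn by simp
      also have "\<dots> = (H n \<cdot>\<^bsub>B\<^esub> H m) \<cdot>\<^bsub>B\<^esub> \<iota>o ?a j"
        using B.cmp_assoc[OF \<iota>a Hm Hn] by simp
      finally show "H (n \<cdot>\<^bsub>A\<^esub> m) \<cdot>\<^bsub>B\<^esub> \<iota>o ?a j = (H n \<cdot>\<^bsub>B\<^esub> H m) \<cdot>\<^bsub>B\<^esub> \<iota>o ?a j" .
    qed
    then show "amap P (n \<cdot>\<^bsub>A\<^esub> m) = amap P n \<cdot>\<^bsub>B\<^esub> amap P m" using m n nm by (simp add: P_def)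
  qed (simp_all add: P_def)
  define \<iota> where "\<iota> j = \<lparr>nsrc = X j, ntgt = P, component = (\<lambda>a \<in> obj A. \<iota>o a j)\<rparr>" for j
  have \<iota>: "\<iota> j \<in> hom (fun_cat A B) (X j) P" if j: "j \<in> J" for j
  proof -
    have "is_nt A B (\<iota> j)"
    proof (rule ntI)
      fix m assume m: "m \<in> arr A"
      show "component (\<iota> j) (tgt A m) \<cdot>\<^bsub>B\<^esub> amap (nsrc (\<iota> j)) m
          = amap (ntgt (\<iota> j)) m \<cdot>\<^bsub>B\<^esub> component (\<iota> j) (src A m)"
        using H(2)[OF m j] m category.src_obj[OF A m] category.tgt_obj[OF A m]
        by (simp add: \<iota>_def P_def)
    qed (use coproductD(3)[OF cop _] j X[OF j] P in \<open>auto simp: \<iota>_def P_def hom_def\<close>)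
    then show ?thesis by (simp add: hom_def) (simp add: \<iota>_def)
  qed
  have pw: "is_coproduct B J (\<lambda>j. omap (X j) a) (omap P a) (\<lambda>j. component (\<iota> j) a)"
    if "a \<in> obj A" for a
    using cop[OF that] that by (simp add: \<iota>_def P_def)
  show ?thesis
    by (rule that[OF coproduct_fun_catI[OF A B X P \<iota> pw] pw])
qed

lemma finite_coproducts_fun_cat:
  assumes A: "category A" and B: "category B" and fin: "has_finite_coproducts B"
  shows "has_finite_coproducts (fun_cat A B)"
  unfolding has_finite_coproducts_def
proof (intro allI impI ballI)
  fix J :: "nat set" and X assume J: "finite J" and "X \<in> J \<rightarrow> obj (fun_cat A B)"
  then have X: "is_functor A B (X j)" if "j \<in> J" for j using that by auto
  have "\<exists>P \<iota>. is_coproduct B J (\<lambda>j. omap (X j) a) P \<iota>" if "a \<in> obj A" for a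
    by (rule ex_finite_coproduct[OF fin J functorD(3)[OF X that]])
  from ex_objectwise_coproduct[OF A B X this] show "\<exists>P \<iota>. is_coproduct (fun_cat A B) J X P \<iota>"
    by metis
qed

text \<open>Any finite coproduct of functors is isomorphic to the objectwise one, hence is itself
  computed objectwise.\<close>

lemma coproduct_eval:
  assumes A: "category A" and B: "category B" and fin: "has_finite_coproducts B"
    and J: "finite J" and P: "is_coproduct (fun_cat A B) J X P \<iota>" and a: "a \<in> obj A"
  shows "is_coproduct B J (\<lambda>j. omap (X j) a) (omap P a) (\<lambda>j. component (\<iota> j) a)"
proof -
  have X: "is_functor A B (X j)" if "j \<in> J" for j using coproductD(2)[OF P that] by simp
  have "\<exists>P \<iota>. is_coproduct B J (\<lambda>j. omap (X j) a) P \<iota>" if "a \<in> obj A" for a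
    by (rule ex_finite_coproduct[OF fin J functorD(3)[OF X that]])
  from ex_objectwise_coproduct[OF A B X this] obtain Q q where
    Q: "is_coproduct (fun_cat A B) J X Q q" and
    Qa: "\<And>a. a \<in> obj A \<Longrightarrow> is_coproduct B J (\<lambda>j. omap (X j) a) (omap Q a) (\<lambda>j. component (q j) a)"
    by metis
  obtain h k where h: "h \<in> hom (fun_cat A B) Q P" and k: "k \<in> hom (fun_cat A B) P Q"
    and kh: "k \<cdot>\<^bsub>fun_cat A B\<^esub> h = ident (fun_cat A B) Q"
    and hk: "h \<cdot>\<^bsub>fun_cat A B\<^esub> k = ident (fun_cat A B) P"
    and \<iota>: "\<And>j. j \<in> J \<Longrightarrow> \<iota> j = h \<cdot>\<^bsub>fun_cat A B\<^esub> q j"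
    using coproduct_unique[OF category_fun_cat[OF A B] Q P] by metis
  show ?thesis
  proof (rule coproduct_transfer[OF B Qa[OF a]])
    show "component h a \<in> hom B (omap Q a) (omap P a)" "component k a \<in> hom B (omap P a) (omap Q a)"
      using h k a by (auto simp: hom_def ntD)
    show "component k a \<cdot>\<^bsub>B\<^esub> component h a = ident B (omap Q a)"
      using arg_cong[OF kh, of "\<lambda>t. component t a"] a by simp
    show "component h a \<cdot>\<^bsub>B\<^esub> component k a = ident B (omap P a)"
      using arg_cong[OF hk, of "\<lambda>t. component t a"] a by simp
    show "component (\<iota> j) a = component h a \<cdot>\<^bsub>B\<^esub> component (q j) a" if "j \<in> J" for j
      using \<iota>[OF that] a by simp
  qed
qed

text \<open>Hence, if \<open>C\<close> has finite coproducts, fixing the inner variable preserves them. For \<open>A = \<Delta>\<^sup>o\<^sup>p\<close> this turns coproducts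
  of simplicial objects in \<open>Fun(B,C)\<close> into coproducts of simplicial objects in \<open>C\<close>.\<close>

lemma coproduct_slice:
  assumes A: "category A" and B: "category B" and C: "category C" and fin: "has_finite_coproducts C"
    and J: "finite J" and P: "is_coproduct (fun_cat A (fun_cat B C)) J X P \<iota>" and b: "b \<in> obj B"
  shows "is_coproduct (fun_cat A C) J (\<lambda>j. slice A (X j) b) (slice A P b)
    (\<lambda>j. component (amap (swap A B C) (\<iota> j)) b)"
proof (rule coproduct_fun_catI[OF A C])
  note BC = category_fun_cat[OF B C] and fin' = finite_coproducts_fun_cat[OF B C fin]
  show "is_functor A C (slice A P b)" using functor_slice[OF A _ b] coproductD(1)[OF P] by simp
  fix j assume j: "j \<in> J"
  show "is_functor A C (slice A (X j) b)"
    using functor_slice[OF A _ b] coproductD(2)[OF P j] by simp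
  have "is_nt A (fun_cat B C) (\<iota> j)" "nsrc (\<iota> j) = X j" "ntgt (\<iota> j) = P"
    using coproductD(3)[OF P j] by (auto simp: hom_def)
  then show "component (amap (swap A B C) (\<iota> j)) b \<in> hom (fun_cat A C) (slice A (X j) b) (slice A P b)"
    using nt_swap_component[OF A _ b] b by (auto simp: hom_def)
next
  note BC = category_fun_cat[OF B C] and fin' = finite_coproducts_fun_cat[OF B C fin]
  fix a assume a: "a \<in> obj A"
  have \<iota>: "is_nt A (fun_cat B C) (\<iota> j)" if "j \<in> J" for j
    using coproductD(3)[OF P that] by (auto simp: hom_def)
  have "is_coproduct C J (\<lambda>j. omap (omap (X j) a) b) (omap (omap P a) b)
      (\<lambda>j. component (component (\<iota> j) a) b)"
    by (rule coproduct_eval[OF B C fin J coproduct_eval[OF A BC fin' J P a] b])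
  then show "is_coproduct C J (\<lambda>j. omap (slice A (X j) b) a) (omap (slice A P b) a)
      (\<lambda>j. component (component (amap (swap A B C) (\<iota> j)) b) a)"
    using a b \<iota> by (subst is_coproduct_cong) auto
qed

lemma bin_coproduct_eval:
  assumes A: "category A" and B: "category B" and fin: "has_finite_coproducts B"
    and P: "is_bin_coproduct (fun_cat A B) X Y P i j" and a: "a \<in> obj A"
  shows "is_bin_coproduct B (omap X a) (omap Y a) (omap P a) (component i a) (component j a)"
  unfolding is_bin_coproduct_def
  by (rule is_coproduct_cong[THEN iffD1, OF _ _
        coproduct_eval[OF A B fin finite P[unfolded is_bin_coproduct_def] a]])
    (simp_all split: bool.split)

lemma bin_coproduct_slice:
  assumes A: "category A" and B: "category B" and C: "category C" and fin: "has_finite_coproducts C"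
    and P: "is_bin_coproduct (fun_cat A (fun_cat B C)) X Y P i j" and b: "b \<in> obj B"
  shows "is_bin_coproduct (fun_cat A C) (slice A X b) (slice A Y b) (slice A P b)
    (component (amap (swap A B C) i) b) (component (amap (swap A B C) j) b)"
  unfolding is_bin_coproduct_def
  by (rule is_coproduct_cong[THEN iffD1, OF _ _
        coproduct_slice[OF A B C fin finite P[unfolded is_bin_coproduct_def] b]])
    (simp_all split: bool.split)

lemma relative_category_fin_coprod_fun_cat:
  assumes A: "category A" and D: "relative_category_fin_coprod D E"
  shows "relative_category_fin_coprod (fun_cat A D) (objectwise A D E)"
proof -
  interpret D: relative_category_fin_coprod D E by (rule D)
  note Dc = D.category_axioms
  interpret F: category "fun_cat A D" by (rule category_fun_cat[OF A Dc])
  show ?thesis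
  proof unfold_locales
    show "saturated (fun_cat A D) (objectwise A D E)"
      by (rule saturated_objectwise[OF A Dc D.saturated])
    show "has_finite_coproducts (fun_cat A D)"
      by (rule finite_coproducts_fun_cat[OF A Dc D.finite_coproducts])
    fix f g P i j Q k l h
    assume f: "f \<in> objectwise A D E" and g: "g \<in> objectwise A D E"
      and P: "is_bin_coproduct (fun_cat A D) (src (fun_cat A D) f) (src (fun_cat A D) g) P i j"
      and Q: "is_bin_coproduct (fun_cat A D) (tgt (fun_cat A D) f) (tgt (fun_cat A D) g) Q k l"
      and h: "h \<in> hom (fun_cat A D) P Q"
      and hi: "h \<cdot>\<^bsub>fun_cat A D\<^esub> i = k \<cdot>\<^bsub>fun_cat A D\<^esub> f"
      and hj: "h \<cdot>\<^bsub>fun_cat A D\<^esub> j = l \<cdot>\<^bsub>fun_cat A D\<^esub> g"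
    have "component h a \<in> E" if a: "a \<in> obj A" for a
    proof (rule D.coprod_weq[of "component f a" "component g a"])
      have f': "is_nt A D f" and g': "is_nt A D g" using f g by (auto simp: objectwise_def)
      show "component f a \<in> E" "component g a \<in> E" using f g a by (auto simp: objectwise_def)
      show "is_bin_coproduct D (src D (component f a)) (src D (component g a)) (omap P a)
          (component i a) (component j a)"
        using bin_coproduct_eval[OF A Dc D.finite_coproducts P a] ntD(5)[OF f' a] ntD(5)[OF g' a]
        by simp
      show "is_bin_coproduct D (tgt D (component f a)) (tgt D (component g a)) (omap Q a)
          (component k a) (component l a)"
        using bin_coproduct_eval[OF A Dc D.finite_coproducts Q a] ntD(6)[OF f' a] ntD(6)[OF g' a]
        by simp
      show "component h a \<in> hom D (omap P a) (omap Q a)"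
        using h a by (auto simp: hom_def ntD)
      show "component h a \<cdot>\<^bsub>D\<^esub> component i a = component k a \<cdot>\<^bsub>D\<^esub> component f a"
        using arg_cong[OF hi, of "\<lambda>t. component t a"] a by simp
      show "component h a \<cdot>\<^bsub>D\<^esub> component j a = component l a \<cdot>\<^bsub>D\<^esub> component g a"
        using arg_cong[OF hj, of "\<lambda>t. component t a"] a by simp
    qed
    then show "h \<in> objectwise A D E" using h by (simp add: objectwise_def hom_def)
  qed
qed

section \<open>Simplicial objects in functor categories\<close>

lemma Delta_arrD:
  assumes "f \<in> arr Delta"
  shows "x \<le> dsrc f \<Longrightarrow> dfun f x \<le> dtgt f"
    and "x \<le> y \<Longrightarrow> y \<le> dsrc f \<Longrightarrow> dfun f x \<le> dfun f y"
    and "dfun f \<in> extensional {..dsrc f}"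
  using assms by (auto simp: Delta_def PiE_def Pi_def mono_on_def)

lemma Delta_arrI:
  assumes "\<And>x. x \<le> dsrc f \<Longrightarrow> dfun f x \<le> dtgt f"
    and "\<And>x y. x \<le> y \<Longrightarrow> y \<le> dsrc f \<Longrightarrow> dfun f x \<le> dfun f y"
    and "dfun f \<in> extensional {..dsrc f}"
  shows "f \<in> arr Delta"
  using assms by (auto simp: Delta_def PiE_def Pi_def mono_on_def)

lemma Delta_simps [simp]:
  "obj Delta = UNIV" "src Delta = dsrc" "tgt Delta = dtgt"
  "dsrc (g \<cdot>\<^bsub>Delta\<^esub> f) = dsrc f" "dtgt (g \<cdot>\<^bsub>Delta\<^esub> f) = dtgt g"
  "dfun (g \<cdot>\<^bsub>Delta\<^esub> f) = compose {..dsrc f} (dfun g) (dfun f)"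
  by (simp_all add: Delta_def)

lemma smap_eqI:
  fixes f g :: smap
  assumes "f \<in> arr Delta" "g \<in> arr Delta" "dsrc f = dsrc g" "dtgt f = dtgt g"
    and "\<And>x. x \<le> dsrc g \<Longrightarrow> dfun f x = dfun g x"
  shows "f = g"
proof (rule smap.equality)
  show "dfun f = dfun g"
    by (rule extensionalityI[where A = "{..dsrc g}"])
      (use Delta_arrD(3)[OF assms(1)] Delta_arrD(3)[OF assms(2)] assms in auto)
qed (use assms in auto)

lemma Delta_cmp_arr:
  assumes "f \<in> arr Delta" "g \<in> arr Delta" "dtgt f = dsrc g"
  shows "g \<cdot>\<^bsub>Delta\<^esub> f \<in> arr Delta"
  by (rule Delta_arrI) (use Delta_arrD[OF assms(1)] Delta_arrD[OF assms(2)] assms(3) in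
    \<open>auto simp: compose_eq\<close>)

lemma Delta_ident_arr: "ident Delta n \<in> arr Delta"
  by (rule Delta_arrI) (auto simp: Delta_def)

lemma category_Delta: "category Delta"
proof
  fix f A B assume "f \<in> hom Delta A B"
  then have f: "f \<in> arr Delta" "dsrc f = A" "dtgt f = B" by (auto simp: hom_def)
  have i: "dsrc (ident Delta n) = n" "dtgt (ident Delta n) = n"
    "x \<le> n \<Longrightarrow> dfun (ident Delta n) x = x" for n x
    by (simp_all add: Delta_def)
  show "ident Delta B \<cdot>\<^bsub>Delta\<^esub> f = f" "f \<cdot>\<^bsub>Delta\<^esub> ident Delta A = f"
    by (rule smap_eqI; use f Delta_arrD[OF f(1)] in
      \<open>auto simp: i Delta_cmp_arr Delta_ident_arr compose_eq\<close>)+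
next
  fix f g h A B B' B''
  assume "f \<in> hom Delta A B" "g \<in> hom Delta B B'" "h \<in> hom Delta B' B''"
  then have *: "f \<in> arr Delta" "g \<in> arr Delta" "h \<in> arr Delta" "dtgt f = dsrc g" "dtgt g = dsrc h"
    by (auto simp: hom_def)
  show "(h \<cdot>\<^bsub>Delta\<^esub> g) \<cdot>\<^bsub>Delta\<^esub> f = h \<cdot>\<^bsub>Delta\<^esub> (g \<cdot>\<^bsub>Delta\<^esub> f)"
    by (rule smap_eqI) (use * Delta_arrD[OF *(1)] in \<open>auto simp: Delta_cmp_arr compose_eq\<close>)
qed (use Delta_ident_arr Delta_cmp_arr in \<open>auto simp: hom_def\<close>, auto simp: Delta_def)

lemmas category_Dop = category_op_cat[OF category_Delta]

lemma Dop_simps [simp]: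
  "obj Dop = UNIV" "arr Dop = arr Delta" "src Dop = dtgt" "tgt Dop = dsrc"
  "g \<cdot>\<^bsub>Dop\<^esub> f = f \<cdot>\<^bsub>Delta\<^esub> g"
  by (simp_all add: op_cat_def)

lemma diag_ob_simps [simp]:
  "omap (diag_ob D Z) n = omap (omap Z n) n"
  "\<theta> \<in> arr Delta \<Longrightarrow> amap (diag_ob D Z) \<theta>
    = amap (omap Z (dsrc \<theta>)) \<theta> \<cdot>\<^bsub>D\<^esub> component (amap Z \<theta>) (dtgt \<theta>)"
  by (simp_all add: diag_ob_def)

lemma diag_simps [simp]:
  "is_functor Dop (scat D) Z \<Longrightarrow> omap (diag D) Z = diag_ob D Z"
  "is_nt Dop (scat D) t \<Longrightarrow> nsrc (amap (diag D) t) = diag_ob D (nsrc t)"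
  "is_nt Dop (scat D) t \<Longrightarrow> ntgt (amap (diag D) t) = diag_ob D (ntgt t)"
  "is_nt Dop (scat D) t \<Longrightarrow> component (amap (diag D) t) n = component (component t n) n"
  by (simp_all add: diag_def)

text \<open>The two simplicial operators of a bisimplicial object: \<open>amap (omap Z k) \<theta>\<close> acts on the inner index,
  \<open>component (amap Z \<theta>) m\<close> on the outer one.\<close>

lemma bisimplicial_arr:
  assumes Z: "is_functor Dop (scat D) Z" and \<theta>: "\<theta> \<in> arr Delta"
  shows "amap (omap Z k) \<theta> \<in> hom D (omap (omap Z k) (dtgt \<theta>)) (omap (omap Z k) (dsrc \<theta>))"
    and "component (amap Z \<theta>) m \<in> hom D (omap (omap Z (dtgt \<theta>)) m) (omap (omap Z (dsrc \<theta>)) m)"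
proof -
  have "is_functor Dop D (omap Z k)" using functorD(3)[OF Z, of k] by simp
  from functorD(4-6)[OF this, of \<theta>] show "amap (omap Z k) \<theta>
      \<in> hom D (omap (omap Z k) (dtgt \<theta>)) (omap (omap Z k) (dsrc \<theta>))"
    using \<theta> by (simp add: hom_def)
  have "is_nt Dop D (amap Z \<theta>)" "nsrc (amap Z \<theta>) = omap Z (dtgt \<theta>)"
    "ntgt (amap Z \<theta>) = omap Z (dsrc \<theta>)"
    using functorD(4-6)[OF Z, of \<theta>] \<theta> by simp_all
  then show "component (amap Z \<theta>) m \<in> hom D (omap (omap Z (dtgt \<theta>)) m) (omap (omap Z (dsrc \<theta>)) m)"
    using ntD(4-6)[of Dop D "amap Z \<theta>" m] by (simp add: hom_def)
qed

lemma functor_diag_ob: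
  assumes D: "category D" and Z: "is_functor Dop (scat D) Z"
  shows "is_functor Dop D (diag_ob D Z)"
proof (rule functorI)
  interpret D: category D by (rule D)
  have Zn: "is_functor Dop D (omap Z n)" for n using functorD(3)[OF Z, of n] by simp
  note Zar = bisimplicial_arr[OF Z]
  show "omap (diag_ob D Z) \<in> extensional (obj Dop)" "amap (diag_ob D Z) \<in> extensional (arr Dop)"
    by (simp_all add: diag_ob_def)
  { fix n
    show "omap (diag_ob D Z) n \<in> obj D" using functorD(3)[OF Zn] by simp
    note i = ident_arr[OF category_Delta, of n, simplified]
    have "ident Dop n = ident Delta n" by (simp add: op_cat_def)
    then show "amap (diag_ob D Z) (ident Dop n) = ident D (omap (diag_ob D Z) n)"
      using functorD(7)[OF Zn, of n n] functorD(7)[OF Z, of n] functorD(3)[OF Zn, of n n]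
        cmp_ident_arr[OF D ident_arr(1)[OF D]] ident_arr[OF D]
      by (simp add: i) }
  { fix \<theta> assume "\<theta> \<in> arr Dop"
    then have \<theta>: "\<theta> \<in> arr Delta" by simp
    then show "amap (diag_ob D Z) \<theta> \<in> arr D"
      "src D (amap (diag_ob D Z) \<theta>) = omap (diag_ob D Z) (src Dop \<theta>)"
      "tgt D (amap (diag_ob D Z) \<theta>) = omap (diag_ob D Z) (tgt Dop \<theta>)"
      using D.cmp_hom[OF Zar(2)[OF \<theta>, of "dtgt \<theta>"] Zar(1)[OF \<theta>]] by (auto simp: hom_def) }
  fix \<theta> \<phi> assume "\<theta> \<in> arr Dop" "\<phi> \<in> arr Dop" "tgt Dop \<theta> = src Dop \<phi>"
  then have \<theta>: "\<theta> \<in> arr Delta" and \<phi>: "\<phi> \<in> arr Delta" and \<theta>\<phi>: "dsrc \<theta> = dtgt \<phi>" by auto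
  let ?a = "dtgt \<theta>" and ?b = "dtgt \<phi>" and ?c = "dsrc \<phi>"
  have 1: "amap (omap Z ?c) (\<theta> \<cdot>\<^bsub>Delta\<^esub> \<phi>) = amap (omap Z ?c) \<phi> \<cdot>\<^bsub>D\<^esub> amap (omap Z ?c) \<theta>"
    using functorD(8)[OF Zn, of \<theta> \<phi>] \<theta> \<phi> \<theta>\<phi> by simp
  have 2: "component (amap Z (\<theta> \<cdot>\<^bsub>Delta\<^esub> \<phi>)) ?a = component (amap Z \<phi>) ?a \<cdot>\<^bsub>D\<^esub> component (amap Z \<theta>) ?a"
    using functorD(8)[OF Z, of \<theta> \<phi>] \<theta> \<phi> \<theta>\<phi> by simp
  have n\<phi>: "is_nt Dop D (amap Z \<phi>)" "nsrc (amap Z \<phi>) = omap Z ?b" "ntgt (amap Z \<phi>) = omap Z ?c"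
    using functorD(4-6)[OF Z, of \<phi>] \<phi> by simp_all
  \<comment> \<open>Outer and inner operators commute, as \<open>Z \<phi>\<close> is natural.\<close>
  have 3: "component (amap Z \<phi>) ?b \<cdot>\<^bsub>D\<^esub> amap (omap Z ?b) \<theta>
      = amap (omap Z ?c) \<theta> \<cdot>\<^bsub>D\<^esub> component (amap Z \<phi>) ?a"
    using ntD(7)[OF n\<phi>(1), of \<theta>] n\<phi> \<theta> \<theta>\<phi> by simp
  have p: "amap (omap Z ?c) \<phi> \<in> hom D (omap (omap Z ?c) ?b) (omap (omap Z ?c) ?c)"
    and q: "amap (omap Z ?c) \<theta> \<in> hom D (omap (omap Z ?c) ?a) (omap (omap Z ?c) ?b)"
    and r: "component (amap Z \<phi>) ?a \<in> hom D (omap (omap Z ?b) ?a) (omap (omap Z ?c) ?a)"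
    and r': "component (amap Z \<phi>) ?b \<in> hom D (omap (omap Z ?b) ?b) (omap (omap Z ?c) ?b)"
    and q': "amap (omap Z ?b) \<theta> \<in> hom D (omap (omap Z ?b) ?a) (omap (omap Z ?b) ?b)"
    and s: "component (amap Z \<theta>) ?a \<in> hom D (omap (omap Z ?a) ?a) (omap (omap Z ?b) ?a)"
    using Zar \<theta> \<phi> \<theta>\<phi> by metis+
  let ?p = "amap (omap Z ?c) \<phi>" and ?q = "amap (omap Z ?c) \<theta>" and ?r = "component (amap Z \<phi>) ?a"
    and ?r' = "component (amap Z \<phi>) ?b" and ?q' = "amap (omap Z ?b) \<theta>"
    and ?s = "component (amap Z \<theta>) ?a"
  have "(?p \<cdot>\<^bsub>D\<^esub> ?q) \<cdot>\<^bsub>D\<^esub> (?r \<cdot>\<^bsub>D\<^esub> ?s) = ?p \<cdot>\<^bsub>D\<^esub> ((?q \<cdot>\<^bsub>D\<^esub> ?r) \<cdot>\<^bsub>D\<^esub> ?s)"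
    using D.cmp_assoc[OF D.cmp_hom[OF s r] q p] D.cmp_assoc[OF s r q] by simp
  also have "\<dots> = (?p \<cdot>\<^bsub>D\<^esub> ?r') \<cdot>\<^bsub>D\<^esub> (?q' \<cdot>\<^bsub>D\<^esub> ?s)"
    unfolding 3[symmetric]
    using D.cmp_assoc[OF D.cmp_hom[OF s q'] r' p] D.cmp_assoc[OF s q' r'] by simp
  finally show "amap (diag_ob D Z) (\<phi> \<cdot>\<^bsub>Dop\<^esub> \<theta>) = amap (diag_ob D Z) \<phi> \<cdot>\<^bsub>D\<^esub> amap (diag_ob D Z) \<theta>"
    using \<theta> \<phi> \<theta>\<phi> by (simp add: Delta_cmp_arr 1 2)
qed

lemma functor_diag:
  assumes D: "category D"
  shows "is_functor (scat (scat D)) (scat D) (diag D)"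
proof (rule functorI)
  interpret D: category D by (rule D)
  note cS = category_fun_cat[OF category_Dop D]
  show "omap (diag D) \<in> extensional (obj (scat (scat D)))"
    "amap (diag D) \<in> extensional (arr (scat (scat D)))"
    by (simp_all add: diag_def del: fun_cat_simps)
  { fix Z assume "Z \<in> obj (scat (scat D))"
    then have Z: "is_functor Dop (scat D) Z" by simp
    then show "omap (diag D) Z \<in> obj (scat D)" using functor_diag_ob[OF D Z] by simp
    show "amap (diag D) (ident (scat (scat D)) Z) = ident (scat D) (omap (diag D) Z)"
      by (rule nt_eqI[where S = UNIV]) (use nt_ident[OF category_Dop cS Z] Z in simp_all) }
  { fix t assume "t \<in> arr (scat (scat D))"
    then have t: "is_nt Dop (scat D) t" by simp
    have tn: "is_nt Dop D (component t n)" "nsrc (component t n) = omap (nsrc t) n"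
      "ntgt (component t n) = omap (ntgt t) n" for n
      using ntD(4-6)[OF t, of n] by simp_all
    have "is_nt Dop D (amap (diag D) t)"
    proof (rule ntI)
      fix \<theta> assume "\<theta> \<in> arr Dop"
      then have \<theta>: "\<theta> \<in> arr Delta" by simp
      let ?a = "dtgt \<theta>" and ?b = "dsrc \<theta>"
      note z = bisimplicial_arr[OF ntD(1)[OF t] \<theta>] and z' = bisimplicial_arr[OF ntD(2)[OF t] \<theta>]
      have c: "component (component t k) m \<in> hom D (omap (omap (nsrc t) k) m) (omap (omap (ntgt t) k) m)"
        for k m using ntD(4-6)[OF tn(1)[of k], of m] tn by (simp add: hom_def)
      have n1: "component (component t ?b) ?b \<cdot>\<^bsub>D\<^esub> amap (omap (nsrc t) ?b) \<theta>
          = amap (omap (ntgt t) ?b) \<theta> \<cdot>\<^bsub>D\<^esub> component (component t ?b) ?a"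
        using ntD(7)[OF tn(1)[of ?b], of \<theta>] tn \<theta> by simp
      have n2: "component (component t ?b) ?a \<cdot>\<^bsub>D\<^esub> component (amap (nsrc t) \<theta>) ?a
          = component (amap (ntgt t) \<theta>) ?a \<cdot>\<^bsub>D\<^esub> component (component t ?a) ?a"
        using arg_cong[OF ntD(7)[OF t, of \<theta>], of "\<lambda>u. component u ?a"] \<theta> by simp
      show "component (amap (diag D) t) (tgt Dop \<theta>) \<cdot>\<^bsub>D\<^esub> amap (nsrc (amap (diag D) t)) \<theta>
          = amap (ntgt (amap (diag D) t)) \<theta> \<cdot>\<^bsub>D\<^esub> component (amap (diag D) t) (src Dop \<theta>)"
        using D.cmp_assoc[OF z(2) z(1) c] D.cmp_assoc[OF z(2) c z'(1)] D.cmp_assoc[OF c z'(2) z'(1)] t \<theta>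
        by (simp add: n1 n2)
    next
      show "component (amap (diag D) t) \<in> extensional (obj Dop)" by simp
    qed (use t functor_diag_ob[OF D ntD(1)[OF t]] functor_diag_ob[OF D ntD(2)[OF t]]
        ntD(4-6)[OF tn(1)] tn in simp_all)
    then show "amap (diag D) t \<in> arr (scat D)"
      "src (scat D) (amap (diag D) t) = omap (diag D) (src (scat (scat D)) t)"
      "tgt (scat D) (amap (diag D) t) = omap (diag D) (tgt (scat (scat D)) t)"
      using t ntD(1,2)[OF t] by simp_all }
  fix t u assume "t \<in> arr (scat (scat D))" "u \<in> arr (scat (scat D))"
    "tgt (scat (scat D)) t = src (scat (scat D)) u"
  then have t: "is_nt Dop (scat D) t" and u: "is_nt Dop (scat D) u" and tu: "ntgt t = nsrc u" by auto
  show "amap (diag D) (u \<cdot>\<^bsub>scat (scat D)\<^esub> t) = amap (diag D) u \<cdot>\<^bsub>scat D\<^esub> amap (diag D) t"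
    by (rule nt_eqI[where S = UNIV]) (use nt_cmp[OF category_Dop cS u t tu] t u in simp_all)
qed

lemma functor_front2:
  assumes I: "category I" and D: "category D"
  shows "is_functor (scat (scat (fun_cat I D))) (fun_cat I (scat (scat D))) (front2 I D)"
  unfolding front2_def
  by (rule functor_functor_comp[OF _ functor_post[OF category_Dop _ functor_swap[OF category_Dop I D]]
        functor_swap[OF category_Dop I]])
    (intro category_fun_cat category_Dop I D)+

text \<open>The diagonal is formed objectwise.\<close>

lemma front2_diag:
  assumes I: "category I" and D: "category D"
  shows "functor_comp (scat (scat (fun_cat I D))) (post I (scat (scat D)) (diag D)) (front2 I D)
    = functor_comp (scat (scat (fun_cat I D))) (swap Dop I D) (diag (fun_cat I D))"
proof (rule functor_fun_cat2_eqI[OF _ I])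
  note Dop = category_Dop
  note ID = category_fun_cat[OF I D]
  note cS = category_fun_cat[OF Dop D] and cSI = category_fun_cat[OF Dop ID]
  note cSS = category_fun_cat[OF Dop cS] and cSSI = category_fun_cat[OF Dop cSI]
  note sw = functor_swap[OF Dop I D]
  show "category (scat (scat (fun_cat I D)))" by (rule cSSI)
  show "is_functor (scat (scat (fun_cat I D))) (fun_cat I (scat D))
     (functor_comp (scat (scat (fun_cat I D))) (post I (scat (scat D)) (diag D)) (front2 I D))"
    by (rule functor_functor_comp[OF cSSI functor_front2[OF I D] functor_post[OF I cSS functor_diag[OF D]]])
  show "is_functor (scat (scat (fun_cat I D))) (fun_cat I (scat D))
     (functor_comp (scat (scat (fun_cat I D))) (swap Dop I D) (diag (fun_cat I D)))"
    by (rule functor_functor_comp[OF cSSI functor_diag[OF ID] sw])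
  { fix Z assume "Z \<in> obj (scat (scat (fun_cat I D)))"
    then have Z: "is_functor Dop (scat (fun_cat I D)) Z" by simp
    note Y = functor_functor_comp[OF Dop Z sw]
    note Zn = functorD(3)[OF Z, of n for n, simplified]
    note Zm = functorD(4)[OF Z, of \<theta> for \<theta>, simplified]
    note [simp] = Z Y Zn Zm front2_def functor_swap_ob[OF Dop I Y] functor_slice[OF Dop Y]
      functor_diag_ob[OF ID Z] functorD(4)[OF functor_swap_ob[OF Dop I Y], simplified]
    { fix i n assume "i \<in> obj I"
      then show "omap (omap (omap (functor_comp (scat (scat (fun_cat I D)))
          (post I (scat (scat D)) (diag D)) (front2 I D)) Z) i) n
        = omap (omap (omap (functor_comp (scat (scat (fun_cat I D))) (swap Dop I D)
          (diag (fun_cat I D))) Z) i) n" by simp }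
    { fix i \<theta> assume "i \<in> obj I" "\<theta> \<in> arr Dop"
      then show "amap (omap (omap (functor_comp (scat (scat (fun_cat I D)))
          (post I (scat (scat D)) (diag D)) (front2 I D)) Z) i) \<theta>
        = amap (omap (omap (functor_comp (scat (scat (fun_cat I D))) (swap Dop I D)
          (diag (fun_cat I D))) Z) i) \<theta>" by simp }
    { fix g n assume "g \<in> arr I"
      then show "component (amap (omap (functor_comp (scat (scat (fun_cat I D)))
          (post I (scat (scat D)) (diag D)) (front2 I D)) Z) g) n
        = component (amap (omap (functor_comp (scat (scat (fun_cat I D))) (swap Dop I D)
          (diag (fun_cat I D))) Z) g) n" by simp } }
  fix t i n assume "t \<in> arr (scat (scat (fun_cat I D)))" and i: "i \<in> obj I"
  then have t: "is_nt Dop (scat (fun_cat I D)) t" by simp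
  note wt = nt_whisker_left[OF Dop t sw]
  have "is_nt Dop (fun_cat I D) (amap (diag (fun_cat I D)) t)"
    using functorD(4)[OF functor_diag[OF ID], of t] t by simp
  then show "component (component (amap (functor_comp (scat (scat (fun_cat I D)))
          (post I (scat (scat D)) (diag D)) (front2 I D)) t) i) n
        = component (component (amap (functor_comp (scat (scat (fun_cat I D))) (swap Dop I D)
          (diag (fun_cat I D))) t) i) n"
    using t i wt nt_swap[OF Dop I wt] nt_swap_component[OF Dop wt i] ntD(4)[OF t, of n]
    by (simp add: front2_def)
qed

section \<open>Objectwise extension of functors and transformations\<close>

text \<open>For \<open>K : S' \<rightarrow> Fun(I,S)\<close>, sending \<open>F : S \<rightarrow> D\<close> to \<open>Fun(I,F) \<circ> K : S' \<rightarrow> Fun(I,D)\<close> is a functor that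
  preserves objectwise weak equivalences.\<close>

lemma weq_functor_lift:
  assumes I: "category I" and S: "category S" and D: "category D" and S': "category S'"
    and K: "is_functor S' (fun_cat I S) K"
  shows "weq_functor (fun_cat S D) (objectwise S D E)
    (fun_cat S' (fun_cat I D)) (objectwise S' (fun_cat I D) (objectwise I D E))
    (\<lambda>F. functor_comp S' (post I S F) K) (\<lambda>t. whisker_right S' (post_nt I S t) K)"
proof unfold_locales
  have KX: "is_functor I S (omap K X)" if "X \<in> obj S'" for X
    using functorD(3)[OF K that] by simp
  { fix F assume "F \<in> obj (fun_cat S D)"
    then have F: "is_functor S D F" by simp
    show "functor_comp S' (post I S F) K \<in> obj (fun_cat S' (fun_cat I D))"
      using functor_functor_comp[OF S' K functor_post[OF I S F]] by simp
    show "whisker_right S' (post_nt I S (ident (fun_cat S D) F)) K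
        = ident (fun_cat S' (fun_cat I D)) (functor_comp S' (post I S F) K)"
      by (rule nt_eqI[where S = "obj S'"]) (simp_all add: post_nt_ident[OF I S F] KX) }
  { fix t assume "t \<in> arr (fun_cat S D)"
    then have t: "is_nt S D t" by simp
    show "whisker_right S' (post_nt I S t) K \<in> arr (fun_cat S' (fun_cat I D))"
      using nt_whisker_right[OF S' K nt_post_nt[OF I S t]] by simp
    then show "t \<in> objectwise S D E \<Longrightarrow> whisker_right S' (post_nt I S t) K
        \<in> objectwise S' (fun_cat I D) (objectwise I D E)"
      using nt_whisker_right[OF I KX t] by (simp add: objectwise_def KX functorD(3)[OF KX])
    show "src (fun_cat S' (fun_cat I D)) (whisker_right S' (post_nt I S t) K)
        = functor_comp S' (post I S (src (fun_cat S D) t)) K"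
      "tgt (fun_cat S' (fun_cat I D)) (whisker_right S' (post_nt I S t) K)
        = functor_comp S' (post I S (tgt (fun_cat S D) t)) K"
      by simp_all }
  fix t u assume "t \<in> arr (fun_cat S D)" "u \<in> arr (fun_cat S D)"
    "tgt (fun_cat S D) t = src (fun_cat S D) u"
  then have t: "is_nt S D t" and u: "is_nt S D u" and tu: "ntgt t = nsrc u" by auto
  show "whisker_right S' (post_nt I S (u \<cdot>\<^bsub>fun_cat S D\<^esub> t)) K
      = whisker_right S' (post_nt I S u) K \<cdot>\<^bsub>fun_cat S' (fun_cat I D)\<^esub> whisker_right S' (post_nt I S t) K"
    by (rule nt_eqI[where S = "obj S'"]) (simp_all add: post_nt_cmp[OF I S u t tu] KX)
qed

text \<open>If \<open>G' : S' \<rightarrow> S1'\<close> covers \<open>G : S \<rightarrow> S1\<close>, that is, if \<open>Fun(I,G) \<circ> K = K1 \<circ> G'\<close>, then the extension of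
  \<open>F \<circ> G\<close> along \<open>K\<close> is the extension of \<open>F\<close> along \<open>K1\<close> composed with \<open>G'\<close>, and similarly for \<open>t G\<close>.\<close>

lemma lift_functor_comp:
  assumes I: "category I" and S: "category S" and S1: "category S1"
    and G: "is_functor S S1 G" and F: "is_functor S1 D F"
    and K: "is_functor S' (fun_cat I S) K" and G': "is_functor S' S1' G'"
    and square: "functor_comp S' (post I S G) K = functor_comp S' K1 G'"
  shows "functor_comp S' (post I S (functor_comp S F G)) K
    = functor_comp S' (functor_comp S1' (post I S1 F) K1) G'"
  by (simp add: post_comp[OF I S S1 G F] functor_comp_assoc[OF K] functor_comp_assoc[OF G'] square)

lemma lift_whisker_right:
  assumes I: "category I" and S: "category S" and S1: "category S1"
    and G: "is_functor S S1 G" and t: "is_nt S1 D t"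
    and K: "is_functor S' (fun_cat I S) K" and G': "is_functor S' S1' G'"
    and square: "functor_comp S' (post I S G) K = functor_comp S' K1 G'"
  shows "whisker_right S' (post_nt I S (whisker_right S t G)) K
    = whisker_right S' (whisker_right S1' (post_nt I S1 t) K1) G'"
  by (simp add: post_nt_whisker_right[OF I S S1 G t] whisker_right_comp[OF K]
      whisker_right_comp[OF G'] square)

section \<open>Tensors with finite simplicial sets\<close>

lemma finite_hom_Delta: "finite (hom Delta n p)"
proof (rule inj_on_finite)
  show "inj_on dfun (hom Delta n p)"
    by (rule inj_onI) (auto simp: hom_def)
  show "dfun ` hom Delta n p \<subseteq> {..n} \<rightarrow>\<^sub>E {..p}"
    by (auto simp: hom_def Delta_def)
qed (auto intro: finite_PiE)

lemma coface0_to_point: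
  "coface0 \<cdot>\<^bsub>Delta\<^esub> to_point n = \<lparr>dsrc = n, dtgt = 1, dfun = (\<lambda>x \<in> {..n}. 1)\<rparr>"
  by (auto simp: coface0_def to_point_def Delta_def compose_def fun_eq_iff)

text \<open>The summands indexed by the constant maps \<open>[n] \<rightarrow> [1]\<close> with value \<open>1\<close> are preserved by the simplicial
  operators, so their inclusions form a map of simplicial objects.\<close>

lemma nt_d0:
  assumes X: "is_functor Dop D X" and T: "is_tensor D X (std_simplex 1) T \<iota>"
  shows "is_nt Dop D (d0 X T \<iota>)"
proof (rule ntI)
  let ?k = "\<lambda>n. coface0 \<cdot>\<^bsub>Delta\<^esub> to_point n"
  have k: "?k n \<in> simplices (std_simplex 1) n" for n
    by (auto simp: coface0_to_point std_simplex_def hom_def intro!: Delta_arrI)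
  have act: "act (std_simplex 1) \<theta> (?k (dtgt \<theta>)) = ?k (dsrc \<theta>)" if \<theta>: "\<theta> \<in> arr Delta" for \<theta>
    using Delta_arrD(1)[OF \<theta>] unfolding coface0_to_point
    by (auto simp: std_simplex_def Delta_def compose_def fun_eq_iff)
  show "is_functor Dop D (nsrc (d0 X T \<iota>))" "is_functor Dop D (ntgt (d0 X T \<iota>))"
    using X T by (auto simp: d0_def is_tensor_def)
  show "component (d0 X T \<iota>) \<in> extensional (obj Dop)" by simp
  { fix n
    have "is_coproduct D (simplices (std_simplex 1) n) (\<lambda>_. omap X n) (omap T n) (\<iota> n)"
      using T by (simp add: is_tensor_def)
    from coproductD(3)[OF this k] show "component (d0 X T \<iota>) n \<in> arr D"
      "src D (component (d0 X T \<iota>) n) = omap (nsrc (d0 X T \<iota>)) n"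
      "tgt D (component (d0 X T \<iota>) n) = omap (ntgt (d0 X T \<iota>)) n"
      by (auto simp: d0_def hom_def) }
  fix \<theta> assume "\<theta> \<in> arr Dop"
  then have \<theta>: "\<theta> \<in> arr Delta" by simp
  with T k have "amap T \<theta> \<cdot>\<^bsub>D\<^esub> \<iota> (dtgt \<theta>) (?k (dtgt \<theta>))
      = \<iota> (dsrc \<theta>) (act (std_simplex 1) \<theta> (?k (dtgt \<theta>))) \<cdot>\<^bsub>D\<^esub> amap X \<theta>"
    by (simp add: is_tensor_def)
  from this[unfolded act[OF \<theta>]] show "component (d0 X T \<iota>) (tgt Dop \<theta>) \<cdot>\<^bsub>D\<^esub> amap (nsrc (d0 X T \<iota>)) \<theta>
      = amap (ntgt (d0 X T \<iota>)) \<theta> \<cdot>\<^bsub>D\<^esub> component (d0 X T \<iota>) (src Dop \<theta>)"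
    using \<theta> by (simp add: d0_def)
qed

text \<open>Evaluation preserves tensors with degreewise finite simplicial sets, because it preserves finite
  coproducts.\<close>

lemma tensor_slice:
  assumes I: "category I" and D: "category D" and fin: "has_finite_coproducts D"
    and K: "\<And>n. finite (simplices K n)" and T: "is_tensor (fun_cat I D) X K T \<iota>" and i: "i \<in> obj I"
  shows "is_tensor D (slice Dop X i) K (slice Dop T i) (\<lambda>n k. component (\<iota> n k) i)"
  unfolding is_tensor_def
proof (intro conjI allI ballI)
  have T': "is_functor Dop (fun_cat I D) T" using T by (simp add: is_tensor_def)
  show "slice Dop T i \<in> obj (scat D)" using functor_slice[OF category_Dop T' i] by simp
  fix n
  have "is_coproduct (fun_cat I D) (simplices K n) (\<lambda>_. omap X n) (omap T n) (\<iota> n)"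
    using T by (simp add: is_tensor_def)
  from coproduct_eval[OF I D fin K this i]
  show "is_coproduct D (simplices K n) (\<lambda>_. omap (slice Dop X i) n) (omap (slice Dop T i) n)
      (\<lambda>k. component (\<iota> n k) i)" by simp
next
  fix \<theta> k assume \<theta>: "\<theta> \<in> arr Delta" and k: "k \<in> simplices K (dtgt \<theta>)"
  then have "amap T \<theta> \<cdot>\<^bsub>fun_cat I D\<^esub> \<iota> (dtgt \<theta>) k
      = \<iota> (dsrc \<theta>) (act K \<theta> k) \<cdot>\<^bsub>fun_cat I D\<^esub> amap X \<theta>"
    using T by (simp add: is_tensor_def)
  from arg_cong[OF this, of "\<lambda>t. component t i"]
  show "amap (slice Dop T i) \<theta> \<cdot>\<^bsub>D\<^esub> component (\<iota> (dtgt \<theta>) k) i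
      = component (\<iota> (dsrc \<theta>) (act K \<theta> k)) i \<cdot>\<^bsub>D\<^esub> amap (slice Dop X i) \<theta>"
    using \<theta> i by simp
qed

lemma slice_const_ob:
  assumes "i \<in> obj I"
  shows "slice A (const_ob A (fun_cat I D) X) i = const_ob A D (omap X i)"
  by (rule func.equality) (use assms in \<open>auto simp: slice_def const_ob_def fun_eq_iff\<close>)

section \<open>The objectwise descent structure\<close>

theorem proposition1p6:
  fixes I :: "('i, 'j) cat"
    and D :: "('o, 'm) cat"
    and E :: "'m set"
  assumes "category I"
    and "simplicial_descent_structure D E s mu lam"
  shows "simplicial_descent_structure (fun_cat I D) (objectwise I D E)
           (objectwise_simple I D s) (objectwise_mu I D mu) (objectwise_lambda I D lam)"
proof -
  interpret D: simplicial_descent_structure D E s mu lam by (rule assms(2))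
  note I = assms(1) and Dc = D.category_axioms and s = D.S1_functor
    and fin = D.finite_coproducts and Dop = category_Dop
  note ID = category_fun_cat[OF I Dc]
  note S = category_fun_cat[OF Dop Dc] and SI = category_fun_cat[OF Dop ID]
  note SS = category_fun_cat[OF Dop S] and SSI = category_fun_cat[OF Dop SI]
  note IS = category_fun_cat[OF I S]
  let ?sw = "swap Dop I D" and ?sI = "objectwise_simple I D s"
    and ?S' = "scat (fun_cat I D)" and ?SS' = "scat (scat (fun_cat I D))"
  note sw = functor_swap[OF Dop I Dc]
  note front2 = functor_front2[OF I Dc]
  note sI_def = objectwise_simple_def
  have sI: "is_functor ?S' (fun_cat I D) ?sI"
    unfolding sI_def by (rule functor_functor_comp[OF SI sw functor_post[OF I S s]])
  note c = functor_const_functor[OF Dop Dc] and cI = functor_const_functor[OF Dop ID]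
    and cS = functor_const_functor[OF Dop S] and cSI = functor_const_functor[OF Dop SI]
  note psw = functor_post[OF Dop SI sw]

  have mu: "zigzag (fun_cat (scat (scat D)) D) (objectwise (scat (scat D)) D E)
      (functor_comp (scat (scat D)) s (diag D)) mu (simple_simple D s)"
    and lam: "zigzag (fun_cat D D) (objectwise D D E)
      (functor_comp D s (const_functor Dop D)) lam (id_functor D)"
    using D.S2 D.S3 by (auto simp: we_zigzag_def)

  have simple_arr: "component (amap ?sI f) i = amap s (component (amap ?sw f) i)"
    if "is_nt Dop (fun_cat I D) f" "i \<in> obj I" for f i
    using that nt_swap[OF Dop I that(1)] by (simp add: sI_def)
  have simple_ob: "omap (omap ?sI X) i = omap s (slice Dop X i)"
    if "is_functor Dop (fun_cat I D) X" "i \<in> obj I" for X i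
    using that functor_swap_ob[OF Dop I that(1)] by (simp add: sI_def)

  \<comment> \<open>The functors out of which \<open>\<mu>\<close> and \<open>\<lambda>\<close> are built commute with the exchange of variables.\<close>
  have square_simple: "functor_comp ?SS' (post I (scat (scat D)) (post Dop (scat D) s)) (front2 I D)
      = functor_comp ?SS' ?sw (post Dop ?S' ?sI)"
  proof -
    have "functor_comp ?SS' (post I (scat (scat D)) (post Dop (scat D) s)) (front2 I D)
        = functor_comp ?SS' (functor_comp (fun_cat Dop (fun_cat I (scat D)))
            (post I (scat (scat D)) (post Dop (scat D) s)) (swap Dop I (scat D))) (post Dop ?S' ?sw)"
      by (simp add: front2_def functor_comp_assoc[OF psw])
    also have "\<dots> = functor_comp ?SS' ?sw
        (functor_comp ?SS' (post Dop (fun_cat I (scat D)) (post I (scat D) s)) (post Dop ?S' ?sw))"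
      by (simp add: swap_post[OF Dop I S Dc s, symmetric] functor_comp_assoc[OF psw])
    finally show ?thesis
      by (simp add: sI_def post_comp[OF Dop SI IS sw functor_post[OF I S s]])
  qed
  have square_const: "functor_comp ?S' (post I (scat D) (const_functor Dop (scat D))) ?sw
      = functor_comp ?S' (front2 I D) (const_functor Dop ?S')"
    by (simp add: front2_def functor_comp_assoc[OF cSI] post_const[OF Dop SI IS sw]
        functor_comp_assoc[OF sw, symmetric] swap_const[OF Dop I S])
  have square_post_const: "functor_comp ?S' (post I (scat D) (post Dop D (const_functor Dop D))) ?sw
      = functor_comp ?S' (front2 I D) (post Dop (fun_cat I D) (const_functor Dop (fun_cat I D)))"
    by (simp add: front2_def functor_comp_assoc[OF functor_post[OF Dop ID cI]]
        post_comp[OF Dop ID SI cI sw, symmetric] swap_const[OF Dop I Dc] swap_post[OF Dop I Dc S c])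

  interpret F: relative_category_fin_coprod "fun_cat I D" "objectwise I D E"
    by (rule relative_category_fin_coprod_fun_cat[OF I D.relative_category_fin_coprod_axioms])
  interpret L: weq_functor "fun_cat (scat D) D" "objectwise (scat D) D E"
    "fun_cat ?S' (fun_cat I D)" "objectwise ?S' (fun_cat I D) (objectwise I D E)"
    "\<lambda>F. functor_comp ?S' (post I (scat D) F) ?sw" "\<lambda>t. whisker_right ?S' (post_nt I (scat D) t) ?sw"
    by (rule weq_functor_lift[OF I S Dc SI sw])
  interpret L0: weq_functor "fun_cat D D" "objectwise D D E"
    "fun_cat (fun_cat I D) (fun_cat I D)" "objectwise (fun_cat I D) (fun_cat I D) (objectwise I D E)"
    "\<lambda>F. functor_comp (fun_cat I D) (post I D F) (id_functor (fun_cat I D))"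
    "\<lambda>t. whisker_right (fun_cat I D) (post_nt I D t) (id_functor (fun_cat I D))"
    by (rule weq_functor_lift[OF I Dc Dc ID functor_id_functor[OF ID]])
  interpret L2: weq_functor "fun_cat (scat (scat D)) D" "objectwise (scat (scat D)) D E"
    "fun_cat ?SS' (fun_cat I D)" "objectwise ?SS' (fun_cat I D) (objectwise I D E)"
    "\<lambda>F. functor_comp ?SS' (post I (scat (scat D)) F) (front2 I D)"
    "\<lambda>t. whisker_right ?SS' (post_nt I (scat (scat D)) t) (front2 I D)"
    by (rule weq_functor_lift[OF I SS Dc SSI front2])

  \<comment> \<open>\<open>\<lambda>\<close> is extended along the identity of \<open>Fun(I,D)\<close>, as there is no simplicial variable to exchange.\<close>
  have lam_eq: "objectwise_lambda I D lam
      = map (map_step (\<lambda>t. whisker_right (fun_cat I D) (post_nt I D t) (id_functor (fun_cat I D)))) lam"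
    unfolding objectwise_lambda_def
  proof (rule zigzag_map_cong[OF lam])
    fix t assume "t \<in> arr (fun_cat D D)"
    then have t: "is_nt D D t" by simp
    show "post_nt I D t = whisker_right (fun_cat I D) (post_nt I D t) (id_functor (fun_cat I D))"
      by (rule nt_eqI[where S = "obj (fun_cat I D)"])
        (use functor_post[OF I Dc ntD(1)[OF t]] functor_post[OF I Dc ntD(2)[OF t]] in
          \<open>simp_all add: functor_comp_id del: fun_cat_simps\<close>)
  qed
  have post_const_functor: "post I D (const_functor Dop D)
      = functor_comp (fun_cat I D) ?sw (const_functor Dop (fun_cat I D))"
    by (rule swap_const[OF Dop I Dc, symmetric])

  show ?thesis
  proof unfold_locales
    show "is_functor ?S' (fun_cat I D) ?sI" by (rule sI)
  next
    fix X Y P i j Q k l h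
    assume P: "is_bin_coproduct ?S' X Y P i j"
      and Q: "is_bin_coproduct (fun_cat I D) (omap ?sI X) (omap ?sI Y) Q k l"
      and h: "h \<in> hom (fun_cat I D) Q (omap ?sI P)"
      and hk: "h \<cdot>\<^bsub>fun_cat I D\<^esub> k = amap ?sI i" and hl: "h \<cdot>\<^bsub>fun_cat I D\<^esub> l = amap ?sI j"
    have f: "is_functor Dop (fun_cat I D) X" "is_functor Dop (fun_cat I D) Y"
      "is_functor Dop (fun_cat I D) P" "is_nt Dop (fun_cat I D) i" "is_nt Dop (fun_cat I D) j"
      using coproductD(1)[OF P[unfolded is_bin_coproduct_def]]
        coproductD(2,3)[OF P[unfolded is_bin_coproduct_def], of True]
        coproductD(2,3)[OF P[unfolded is_bin_coproduct_def], of False] by (auto simp: hom_def)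
    have "component h a \<in> E" if a: "a \<in> obj I" for a
    proof (rule D.S1_coprod)
      show "is_bin_coproduct (scat D) (slice Dop X a) (slice Dop Y a) (slice Dop P a)
          (component (amap ?sw i) a) (component (amap ?sw j) a)"
        by (rule bin_coproduct_slice[OF Dop I Dc fin P a])
      show "is_bin_coproduct D (omap s (slice Dop X a)) (omap s (slice Dop Y a)) (omap Q a)
          (component k a) (component l a)"
        using bin_coproduct_eval[OF I Dc fin Q a] by (simp add: simple_ob f a)
      show "component h a \<in> hom D (omap Q a) (omap s (slice Dop P a))"
        using h a by (auto simp: hom_def ntD simple_ob f)
      show "component h a \<cdot>\<^bsub>D\<^esub> component k a = amap s (component (amap ?sw i) a)"
        using arg_cong[OF hk, of "\<lambda>t. component t a"] by (simp add: simple_arr f a)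
      show "component h a \<cdot>\<^bsub>D\<^esub> component l a = amap s (component (amap ?sw j) a)"
        using arg_cong[OF hl, of "\<lambda>t. component t a"] by (simp add: simple_arr f a)
    qed
    then show "h \<in> objectwise I D E" using h by (simp add: objectwise_def hom_def)
  next
    have "functor_comp ?SS' (post I (scat (scat D)) (functor_comp (scat (scat D)) s (diag D))) (front2 I D)
        = functor_comp ?SS' ?sI (diag (fun_cat I D))"
      unfolding sI_def
      by (rule lift_functor_comp[OF I SS S functor_diag[OF Dc] s front2 functor_diag[OF ID]
            front2_diag[OF I Dc]])
    moreover have "functor_comp ?SS' (post I (scat (scat D)) (simple_simple D s)) (front2 I D)
        = simple_simple (fun_cat I D) ?sI"
      unfolding simple_simple_def
      by (rule lift_functor_comp[OF I SS S functor_post[OF Dop S s] s front2 functor_post[OF Dop SI sI]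
            square_simple, folded sI_def])
    ultimately show "we_zigzag (fun_cat ?SS' (fun_cat I D)) (objectwise ?SS' (fun_cat I D) (objectwise I D E))
        (functor_comp ?SS' ?sI (diag (fun_cat I D))) (objectwise_mu I D mu) (simple_simple (fun_cat I D) ?sI)"
      using L2.map_we_zigzag[OF D.S2] by (simp add: objectwise_mu_def)
  next
    have "functor_comp (fun_cat I D) (post I D (functor_comp D s (const_functor Dop D)))
          (id_functor (fun_cat I D))
        = functor_comp (fun_cat I D) ?sI (const_functor Dop (fun_cat I D))"
      unfolding sI_def
      by (rule lift_functor_comp[OF I Dc S c s functor_id_functor[OF ID] cI])
        (simp add: functor_comp_id[OF functor_functor_comp[OF ID cI sw]] post_const_functor)
    moreover have "functor_comp (fun_cat I D) (post I D (id_functor D)) (id_functor (fun_cat I D))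
        = id_functor (fun_cat I D)"
      by (simp add: post_id_functor[OF I Dc] functor_comp_id[OF functor_id_functor[OF ID]])
    ultimately show "we_zigzag (fun_cat (fun_cat I D) (fun_cat I D))
        (objectwise (fun_cat I D) (fun_cat I D) (objectwise I D E))
        (functor_comp (fun_cat I D) ?sI (const_functor Dop (fun_cat I D))) (objectwise_lambda I D lam)
        (id_functor (fun_cat I D))"
      using L0.map_we_zigzag[OF D.S3] by (simp add: lam_eq)
  next
    let ?pl = "map (map_step (\<lambda>t. whisker_right (scat D) t (const_functor Dop (scat D)))) mu @
         map (map_step (\<lambda>t. whisker_right (scat D) t s)) lam"
    have "map (map_step (\<lambda>t. whisker_right ?S' (post_nt I (scat D)
          (whisker_right (scat D) t (const_functor Dop (scat D)))) ?sw)) mu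
        = map (map_step (\<lambda>t. whisker_right ?S' (whisker_right ?SS' (post_nt I (scat (scat D)) t)
            (front2 I D)) (const_functor Dop ?S'))) mu"
      by (rule zigzag_map_cong[OF mu])
        (use lift_whisker_right[OF I S SS cS _ sw cSI square_const] in simp)
    moreover have "map (map_step (\<lambda>t. whisker_right ?S' (post_nt I (scat D)
          (whisker_right (scat D) t s)) ?sw)) lam
        = map (map_step (\<lambda>t. whisker_right ?S' (post_nt I D t) ?sI)) lam"
      by (rule zigzag_map_cong[OF lam])
        (simp add: post_nt_whisker_right[OF I S Dc s] whisker_right_comp[OF sw] sI_def)
    \<comment> \<open>The required zigzag is the extension of the one over \<open>D\<close>, so its triviality in the localization is
      inherited from \<open>D\<close>. The same argument applies to the second compatibility condition below.\<close>
    ultimately have eq: "map (map_step (\<lambda>t. whisker_right ?S' (post_nt I (scat D) t) ?sw)) ?pl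
        = map (map_step (\<lambda>t. whisker_right ?S' t (const_functor Dop ?S'))) (objectwise_mu I D mu) @
          map (map_step (\<lambda>t. whisker_right ?S' t ?sI)) (objectwise_lambda I D lam)"
      by (simp add: objectwise_mu_def objectwise_lambda_def step.map_comp comp_def)
    have "loc_eq (fun_cat (scat D) D) (objectwise (scat D) D E) s s ?pl []"
      using D.S3_left by (subst (asm) loc_arr_eq_ident_iff) (simp_all add: s)
    from L.map_loc_eq[OF this]
    show "loc_arr (fun_cat ?S' (fun_cat I D)) (objectwise ?S' (fun_cat I D) (objectwise I D E)) ?sI
        (map (map_step (\<lambda>t. whisker_right ?S' t (const_functor Dop ?S'))) (objectwise_mu I D mu) @
         map (map_step (\<lambda>t. whisker_right ?S' t ?sI)) (objectwise_lambda I D lam)) ?sI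
      = ident (localization (fun_cat ?S' (fun_cat I D)) (objectwise ?S' (fun_cat I D) (objectwise I D E))) ?sI"
      unfolding eq sI_def[symmetric] by (subst loc_arr_eq_ident_iff) (simp_all add: sI)
  next
    let ?c = "post Dop D (const_functor Dop D)"
      and ?c' = "post Dop (fun_cat I D) (const_functor Dop (fun_cat I D))"
    let ?pr = "map (map_step (\<lambda>t. whisker_right (scat D) t ?c)) mu @
         map (map_step (\<lambda>t. whisker_left (scat D) s (post_nt Dop D t))) lam"
    have "map (map_step (\<lambda>t. whisker_right ?S' (post_nt I (scat D) (whisker_right (scat D) t ?c)) ?sw)) mu
        = map (map_step (\<lambda>t. whisker_right ?S' (whisker_right ?SS' (post_nt I (scat (scat D)) t)
            (front2 I D)) ?c')) mu"
      by (rule zigzag_map_cong[OF mu])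
        (use lift_whisker_right[OF I S SS functor_post[OF Dop Dc c] _ sw functor_post[OF Dop ID cI]
          square_post_const] in simp)
    moreover have "map (map_step (\<lambda>t. whisker_right ?S' (post_nt I (scat D)
          (whisker_left (scat D) s (post_nt Dop D t))) ?sw)) lam
        = map (map_step (\<lambda>t. whisker_left ?S' ?sI (post_nt Dop (fun_cat I D) (post_nt I D t)))) lam"
    proof (rule zigzag_map_cong[OF lam])
      fix t assume "t \<in> arr (fun_cat D D)"
      then have t: "is_nt D D t" by simp
      note pt = nt_post_nt[OF Dop Dc t] and pt' = nt_post_nt[OF Dop ID nt_post_nt[OF I Dc t]]
      show "whisker_right ?S' (post_nt I (scat D) (whisker_left (scat D) s (post_nt Dop D t))) ?sw
          = whisker_left ?S' ?sI (post_nt Dop (fun_cat I D) (post_nt I D t))"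
        by (simp add: post_nt_whisker_left[OF I S S pt s] whisker_left_right[OF sw]
            swap_post_nt[OF Dop I Dc Dc t] sI_def whisker_left_comp[OF pt'])
    qed
    ultimately have eq: "map (map_step (\<lambda>t. whisker_right ?S' (post_nt I (scat D) t) ?sw)) ?pr
        = map (map_step (\<lambda>t. whisker_right ?S' t ?c')) (objectwise_mu I D mu) @
          map (map_step (\<lambda>t. whisker_left ?S' ?sI (post_nt Dop (fun_cat I D) t))) (objectwise_lambda I D lam)"
      by (simp add: objectwise_mu_def objectwise_lambda_def step.map_comp comp_def)
    have "loc_eq (fun_cat (scat D) D) (objectwise (scat D) D E) s s ?pr []"
      using D.S3_right by (subst (asm) loc_arr_eq_ident_iff) (simp_all add: s)
    from L.map_loc_eq[OF this]
    show "loc_arr (fun_cat ?S' (fun_cat I D)) (objectwise ?S' (fun_cat I D) (objectwise I D E)) ?sI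
        (map (map_step (\<lambda>t. whisker_right ?S' t ?c')) (objectwise_mu I D mu) @
         map (map_step (\<lambda>t. whisker_left ?S' ?sI (post_nt Dop (fun_cat I D) t))) (objectwise_lambda I D lam)) ?sI
      = ident (localization (fun_cat ?S' (fun_cat I D)) (objectwise ?S' (fun_cat I D) (objectwise I D E))) ?sI"
      unfolding eq sI_def[symmetric] by (subst loc_arr_eq_ident_iff) (simp_all add: sI)
  next
    fix f assume "f \<in> arr ?S'" and fE: "\<forall>n. component f n \<in> objectwise I D E"
    then have f: "is_nt Dop (fun_cat I D) f" by simp
    have "component (amap ?sI f) i \<in> E" if i: "i \<in> obj I" for i
      unfolding simple_arr[OF f i]
      by (rule D.S4) (use nt_swap_component[OF Dop f i] f i fE in \<open>auto simp: objectwise_def swap_def\<close>)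
    then show "amap ?sI f \<in> objectwise I D E"
      using functorD(4)[OF sI, of f] f by (simp add: objectwise_def)
  next
    fix A T \<iota>
    assume A: "A \<in> obj (fun_cat I D)"
      and T: "is_tensor (fun_cat I D) (const_ob Dop (fun_cat I D) A) (std_simplex 1) T \<iota>"
    note cA = functor_const_ob[OF Dop ID A]
    note d = nt_d0[OF cA T]
    have K: "finite (simplices (std_simplex 1) n)" for n
      by (simp add: std_simplex_def finite_hom_Delta)
    have "component (amap ?sI (d0 (const_ob Dop (fun_cat I D) A) T \<iota>)) i \<in> E" if i: "i \<in> obj I" for i
    proof -
      let ?\<iota> = "\<lambda>n k. component (\<iota> n k) i"
      have "component (amap ?sw (d0 (const_ob Dop (fun_cat I D) A) T \<iota>)) i
          = d0 (const_ob Dop D (omap A i)) (slice Dop T i) ?\<iota>"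
        by (rule nt_eqI[where S = UNIV]) (use d i in \<open>simp_all add: d0_def slice_const_ob\<close>)
      moreover have "is_tensor D (const_ob Dop D (omap A i)) (std_simplex 1) (slice Dop T i) ?\<iota>"
        using tensor_slice[OF I Dc fin K T i] by (simp add: slice_const_ob[OF i])
      ultimately show ?thesis
        unfolding simple_arr[OF d i] using D.S5[of "omap A i"] functorD(3)[of I D A i] A i by simp
    qed
    then show "amap ?sI (d0 (const_ob Dop (fun_cat I D) A) T \<iota>) \<in> objectwise I D E"
      using functorD(4)[OF sI, of "d0 (const_ob Dop (fun_cat I D) A) T \<iota>"] d by (simp add: objectwise_def)
  qed
qed

end
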